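(* Let $s,t$ be coprime integers greater than $1$ and $\lambda$ a partition. The following are equivalent: (1) $\lambda\neq\lambda'$, and the only partitions with the same size, $s$-core and $t$-core as $\lambda$ are $\lambda$ and $\lambda'$; (2) $\mathrm{cor}_s(\lambda)$ and $\mathrm{cor}_t(\lambda)$ are both self-conjugate, and $\mathrm{wei}_s(\lambda)-\mathrm{wei}_s(\mathrm{cor}_t(\lambda))=\mathrm{wei}_t(\lambda)-\mathrm{wei}_t(\mathrm{cor}_s(\lambda))=1$.
   Context: Partitions, size $|\lambda|$, conjugate $\lambda'$ (reflection of the Young diagram in the main diagonal); self-conjugate means $\lambda'=\lambda$. A rim $s$-hook is a connected set of $s$ nodes of the rim of the Young diagram (nodes $(r,c)$ with $(r+1,c+1)$ not a node) whose removal leaves a partition's diagram. The $s$-core $\mathrm{cor}_s(\lambda)$ is obtained by repeatedly removing rim $s$-hooks until none remain, and the $s$-weight $\mathrm{wei}_s(\lambda)$ is the number removed. *)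

theory Defs
  imports Main
begin

text \<open>A partition is a weakly decreasing sequence of natural numbers with finitely many nonzero
  terms; rows and columns of its Young diagram are numbered from 0.\<close>

definition is_partition :: "(nat \<Rightarrow> nat) \<Rightarrow> bool" where
  "is_partition p \<longleftrightarrow> antimono p \<and> finite {r. p r \<noteq> 0}"

definition psize :: "(nat \<Rightarrow> nat) \<Rightarrow> nat" where
  "psize p = (\<Sum>r | p r \<noteq> 0. p r)"

definition diagram :: "(nat \<Rightarrow> nat) \<Rightarrow> (nat \<times> nat) set" where
  "diagram p = {(r, c). c < p r}"

definition conjugate :: "(nat \<Rightarrow> nat) \<Rightarrow> nat \<Rightarrow> nat" where
  "conjugate p = (\<lambda>c. card {r. (r, c) \<in> diagram p})"

definition self_conjugate :: "(nat \<Rightarrow> nat) \<Rightarrow> bool" where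
  "self_conjugate p \<longleftrightarrow> conjugate p = p"

definition rim :: "(nat \<Rightarrow> nat) \<Rightarrow> (nat \<times> nat) set" where
  "rim p = {(r, c). (r, c) \<in> diagram p \<and> (r + 1, c + 1) \<notin> diagram p}"

definition adjacent :: "nat \<times> nat \<Rightarrow> nat \<times> nat \<Rightarrow> bool" where
  "adjacent x y \<longleftrightarrow>
     (fst x = fst y \<and> (snd x = snd y + 1 \<or> snd y = snd x + 1)) \<or>
     (snd x = snd y \<and> (fst x = fst y + 1 \<or> fst y = fst x + 1))"

definition connected_nodes :: "(nat \<times> nat) set \<Rightarrow> bool" where
  "connected_nodes H \<longleftrightarrow>
     (\<forall>x\<in>H. \<forall>y\<in>H. (x, y) \<in> {(u, v). u \<in> H \<and> v \<in> H \<and> adjacent u v}\<^sup>*)"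

definition rim_hook :: "nat \<Rightarrow> (nat \<Rightarrow> nat) \<Rightarrow> (nat \<times> nat) set \<Rightarrow> bool" where
  "rim_hook s p H \<longleftrightarrow>
     H \<subseteq> rim p \<and> card H = s \<and> connected_nodes H \<and>
     (\<exists>q. is_partition q \<and> diagram q = diagram p - H)"

definition remove_rim_hook :: "nat \<Rightarrow> (nat \<Rightarrow> nat) \<Rightarrow> (nat \<Rightarrow> nat) \<Rightarrow> bool" where
  "remove_rim_hook s p q \<longleftrightarrow>
     is_partition q \<and> (\<exists>H. rim_hook s p H \<and> diagram q = diagram p - H)"

definition reduces_to_core :: "nat \<Rightarrow> (nat \<Rightarrow> nat) \<Rightarrow> nat \<Rightarrow> (nat \<Rightarrow> nat) \<Rightarrow> bool" where
  "reduces_to_core s p w q \<longleftrightarrow>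
     (remove_rim_hook s ^^ w) p q \<and> \<not> (\<exists>H. rim_hook s q H)"

text \<open>It is a classical fact that, for a partition \<open>p\<close> and \<open>s > 0\<close>, the pair \<open>(w, q)\<close> with
  \<open>reduces_to_core s p w q\<close> exists and is unique; \<open>cor\<close> and \<open>wei\<close> select its components.\<close>

definition cor :: "nat \<Rightarrow> (nat \<Rightarrow> nat) \<Rightarrow> nat \<Rightarrow> nat" where
  "cor s p = (THE q. \<exists>w. reduces_to_core s p w q)"

definition wei :: "nat \<Rightarrow> (nat \<Rightarrow> nat) \<Rightarrow> nat" where
  "wei s p = (THE w. \<exists>q. reduces_to_core s p w q)"

lemma finite_column:
  assumes "is_partition p" shows "finite {r. c < p r}"
  using assms unfolding is_partition_def by (auto elim: finite_subset[rotated])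

lemma diagram_conjugate:
  assumes "is_partition p"
  shows "diagram (conjugate p) = {(c, r). (r, c) \<in> diagram p}"
proof -
  have "r < card {r. c < p r} \<longleftrightarrow> c < p r" for r c
  proof
    assume "c < p r"
    then have "{..r} \<subseteq> {r. c < p r}"
      using assms by (auto simp: is_partition_def dest: antimonoD intro: less_le_trans)
    then show "r < card {r. c < p r}"
      using card_mono[OF finite_column[OF assms]] by (metis Suc_le_eq card_atMost)
  next
    assume *: "r < card {r. c < p r}"
    show "c < p r"
    proof (rule ccontr)
      assume "\<not> c < p r"
      then have "{r. c < p r} \<subseteq> {..<r}"
        using assms by (force simp: is_partition_def not_less dest: antimonoD)
      then show False
        using * card_mono[of "{..<r}" "{r. c < p r}"] by simp
    qed
  qed
  then show ?thesis by (auto simp: diagram_def conjugate_def)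
qed

end

theory Submission
  imports Defs "HOL-Library.Infinite_Set"
begin

text \<open>
  Encode a partition by its bead set \<open>B = {p r - r - 1}\<close>, so that removing a rim \<open>s\<close>-hook moves a bead
  from \<open>b\<close> to \<open>b - s\<close> and conjugation is the complement followed by \<open>x \<mapsto> - 1 - x\<close>. The \<open>s\<close>-core is
  determined by the charges of \<open>B\<close> on the residue classes modulo \<open>s\<close>, and the \<open>s\<close>-weight is the number
  of pairs \<open>c < b\<close> with \<open>b \<in> B\<close>, \<open>c \<notin> B\<close> and \<open>b \<equiv> c\<close> modulo \<open>s\<close>. Sorting these pairs by
  \<open>b - c = k s\<close> and \<open>b mod t\<close> writes \<open>wei s p - wei s (cor t p)\<close> as the sum over \<open>k\<close> and \<open>j\<close> of
  \<open>min |X - Y| |Y - X|\<close>, where \<open>X\<close> is the part of \<open>B\<close> in the class of \<open>j\<close> modulo \<open>t\<close> and \<open>Y\<close> is the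
  part in the class of \<open>j - k s\<close>, shifted by \<open>k s\<close>. A nonzero term is a rectangle: two beads
  \<open>a\<close>, \<open>a + k s + l t\<close> and two gaps \<open>a + k s\<close>, \<open>a + l t\<close>.

  If some bead \<open>b\<close> can be moved to \<open>b - s t\<close>, the difference of weights is at least \<open>t\<close>, and moving other
  beads up by \<open>s t\<close> instead gives at least three partitions of the same size with the same cores.
  Otherwise both differences are 1 if and only if there is exactly one rectangle. Swapping
  beads and gaps of a rectangle preserves size and cores. Conversely, there is a function on the
  integers, the sum of a linear function, an \<open>s\<close>-periodic one and a \<open>t\<close>-periodic one, which is
  negative on \<open>B\<close> and positive off \<open>B\<close> except perhaps at the corners of the unique rectangle. Its sum
  over the beads is determined by the size and the cores, which forces any other partition with the same
  data to differ from \<open>p\<close> only at these corners, i.e. to be the swapped one.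
\<close>

section \<open>Charges of bead sets\<close>

definition window :: "int \<Rightarrow> int \<Rightarrow> int set \<Rightarrow> bool" where
  "window M N U \<longleftrightarrow> (\<forall>x. (x < M \<longrightarrow> x \<in> U) \<and> (x \<in> U \<longrightarrow> x < N))"

definition maya :: "int set \<Rightarrow> bool" where
  "maya U \<longleftrightarrow> (\<exists>M N. window M N U)"

text \<open>The regularised cardinality of a set that contains almost all negative and almost no
  nonnegative integers.\<close>

definition reg :: "int set \<Rightarrow> int" where
  "reg U = int (card (U \<inter> {0..})) - int (card ({..<0} - U))"

lemma mayaI: "(\<And>x. x < M \<Longrightarrow> x \<in> U) \<Longrightarrow> (\<And>x. x \<in> U \<Longrightarrow> x < N) \<Longrightarrow> maya U"
  unfolding maya_def window_def by blast

lemma mayaE: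
  assumes "maya U"
  obtains M N where "window M N U"
  using assms unfolding maya_def by blast

lemma window_lower: "window M N U \<Longrightarrow> x \<notin> U \<Longrightarrow> M \<le> x"
  unfolding window_def by (meson not_less)

lemma window_upper: "window M N U \<Longrightarrow> x \<in> U \<Longrightarrow> x < N"
  unfolding window_def by blast

lemma window_mem: "window M N U \<Longrightarrow> x < M \<Longrightarrow> x \<in> U"
  unfolding window_def by blast

lemma window_weaken: "window M N U \<Longrightarrow> M' \<le> M \<Longrightarrow> N \<le> N' \<Longrightarrow> window M' N' U"
  unfolding window_def by (meson less_le_trans)

text \<open>Lowering the cutoff from 0 to \<open>M\<close> adds the beads of \<open>{M..<0}\<close>
  to the count. The remaining points of this interval are exactly the gaps subtracted in
  \<open>reg\<close>, so correcting by the length of the interval restores the value.\<close>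

lemma reg_window:
  assumes w: "window M N U" and M: "M \<le> 0"
  shows "reg U = int (card (U \<inter> {M..})) + M"
proof -
  have f: "finite (U \<inter> {0..})"
    by (rule finite_subset[of _ "{0..<N}"]) (auto intro: window_upper[OF w])
  have 1: "U \<inter> {M..} = (U \<inter> {0..}) \<union> (U \<inter> {M..<0})" using M by auto
  have 2: "card (U \<inter> {M..}) = card (U \<inter> {0..}) + card (U \<inter> {M..<0})"
    unfolding 1 by (rule card_Un_disjoint) (use f in auto)
  have 3: "{M..<0} = (U \<inter> {M..<0}) \<union> ({..<0} - U)" by (auto intro: window_lower[OF w])
  have fin: "finite ({..<0} - U)"
    by (rule finite_subset[of _ "{M..<0}"]) (auto intro: window_lower[OF w])
  have "card {M..<0} = card (U \<inter> {M..<0}) + card ({..<0} - U)"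
    by (subst 3, rule card_Un_disjoint) (use fin in auto)
  then show ?thesis using 2 M by (simp add: reg_def)
qed

lemma maya_common_window:
  assumes "maya U" "maya V"
  obtains M N where "M \<le> c" "window M N U" "window M N V"
proof -
  obtain M N M' N' where *: "window M N U" "window M' N' V"
    using assms unfolding maya_def by blast
  show thesis
    by (rule that[of "min c (min M M')" "max N N'"]) (use * window_weaken in auto)
qed

lemma maya_finite_diff:
  assumes "maya U" "maya V" shows "finite (U - V)"
proof -
  obtain M N where w: "window M N U" "window M N V" using maya_common_window[OF assms] by blast
  then have "U - V \<subseteq> {M..<N}" by (auto intro: window_lower window_upper)
  then show ?thesis using finite_subset by blast
qed

text \<open>Below a common lower bound both sets are full, and above it their intersection cancels.
  Comparing regularised cardinalities thus becomes comparing two finite differences.\<close>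

lemma reg_diff:
  assumes "maya U" "maya V"
  shows "reg U - reg V = int (card (U - V)) - int (card (V - U))"
proof -
  obtain M N where w: "M \<le> 0" "window M N U" "window M N V"
    using maya_common_window[OF assms] by blast
  let ?I = "U \<inter> V \<inter> {M..}"
  have fI: "finite ?I"
    by (rule finite_subset[of _ "{M..<N}"]) (auto intro: window_upper[OF w(2)])
  have U: "U \<inter> {M..} = ?I \<union> (U - V)" and V: "V \<inter> {M..} = ?I \<union> (V - U)"
    by (auto intro: window_lower[OF w(3)] window_lower[OF w(2)])
  have "card (U \<inter> {M..}) = card ?I + card (U - V)" "card (V \<inter> {M..}) = card ?I + card (V - U)"
    unfolding U V by (rule card_Un_disjoint; use fI maya_finite_diff assms in auto)+
  then show ?thesis using reg_window[OF w(2,1)] reg_window[OF w(3,1)] by simp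
qed

lemma reg_mono: "maya U \<Longrightarrow> maya V \<Longrightarrow> U \<subseteq> V \<Longrightarrow> reg U \<le> reg V"
  using reg_diff[of U V] by (simp add: Diff_eq_empty_iff[THEN iffD2])

lemma reg_strict_mono:
  assumes "maya U" "maya V" "U \<subset> V" shows "reg U < reg V"
proof -
  have "U - V = {}" "V - U \<noteq> {}" using assms by auto
  then have "card (V - U) > 0" using maya_finite_diff[OF assms(2,1)] by (simp add: card_gt_0_iff)
  then show ?thesis using reg_diff[OF assms(1,2)] \<open>U - V = {}\<close> by simp
qed

lemma maya_insert:
  assumes "maya U" shows "maya (insert x U)"
proof -
  obtain M N where w: "window M N U" using assms by (rule mayaE)
  show ?thesis
    by (rule mayaI[of M _ "max N (x + 1)"]) (auto simp: less_max_iff_disj intro: window_mem[OF w] dest: window_upper[OF w])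
qed

lemma maya_remove:
  assumes "maya U" shows "maya (U - {x})"
proof -
  obtain M N where w: "window M N U" using assms by (rule mayaE)
  show ?thesis
    by (rule mayaI[of "min M x" _ N]) (auto intro: window_mem[OF w] dest: window_upper[OF w])
qed

lemma reg_insert: "maya U \<Longrightarrow> x \<notin> U \<Longrightarrow> reg (insert x U) = reg U + 1"
  using reg_diff[of "insert x U" U] maya_insert[of U x]
  by (simp add: insert_Diff_if Diff_eq_empty_iff[THEN iffD2] subset_insertI)

section \<open>Moving one bead; shifts and reflections\<close>

definition move_bead :: "int \<Rightarrow> int \<Rightarrow> int set \<Rightarrow> int set" where
  "move_bead b y B = insert y (B - {b})"

lemma maya_move_bead: "maya B \<Longrightarrow> maya (move_bead b y B)"
  unfolding move_bead_def by (intro maya_insert maya_remove)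

lemma reg_move_bead:
  assumes "maya B" "b \<in> B" "y \<notin> B" shows "reg (move_bead b y B) = reg B"
  using reg_insert[OF maya_remove[OF assms(1), of b], of y] reg_insert[OF maya_remove[OF assms(1), of b], of b] assms
  by (auto simp: move_bead_def insert_absorb)

lemma reg_shift:
  assumes "maya U" shows "reg {k. k + c \<in> U} = reg U - c"
proof -
  obtain M N where w: "M \<le> min 0 c" "window M N U"
    using maya_common_window[OF assms assms] by blast
  have "window (M - c) (N - c) {k. k + c \<in> U}"
    unfolding window_def using window_mem[OF w(2)] window_upper[OF w(2)] by force
  from reg_window[OF this] w have "reg {k. k + c \<in> U} = int (card ({k. k + c \<in> U} \<inter> {M - c..})) + (M - c)"
    by simp
  also have "{k. k + c \<in> U} \<inter> {M - c..} = (\<lambda>x. x - c) ` (U \<inter> {M..})" by (force simp: image_iff)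
  also have "card \<dots> = card (U \<inter> {M..})" by (rule card_image) (auto simp: inj_on_def)
  finally show ?thesis using reg_window[OF w(2)] w by simp
qed

lemma maya_reflect: assumes "maya U" shows "maya {k. - 1 - k \<notin> U}"
proof -
  obtain M N where w: "window M N U" using assms by (rule mayaE)
  show ?thesis
  proof (rule mayaI[of "-N" _ "-M"])
    fix x assume "x < - N"
    then show "x \<in> {k. - 1 - k \<notin> U}" using window_upper[OF w, of "- 1 - x"] by auto
  next
    fix x assume "x \<in> {k. - 1 - k \<notin> U}"
    then show "x < - M" using window_lower[OF w, of "- 1 - x"] by auto
  qed
qed

lemma reg_reflect: "reg {k. - 1 - k \<notin> U} = - reg U"
proof -
  have refl: "{x. P (- 1 - x)} = (\<lambda>x. - 1 - x) ` {x. P x}" for P :: "int \<Rightarrow> bool"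
    by (force simp: image_iff)
  have "{k. - 1 - k \<notin> U} \<inter> {0..} = (\<lambda>x. - 1 - x) ` ({..<0} - U)"
  proof -
    have "{k. - 1 - k \<notin> U} \<inter> {0..} = {x. - 1 - x < 0 \<and> - 1 - x \<notin> U}" by auto
    moreover have "{..<0} - U = {x. x < 0 \<and> x \<notin> U}" by auto
    ultimately show ?thesis using refl[of "\<lambda>x. x < 0 \<and> x \<notin> U"] by simp
  qed
  moreover have "{..<0} - {k. - 1 - k \<notin> U} = (\<lambda>x. - 1 - x) ` (U \<inter> {0..})"
  proof -
    have "{..<0} - {k. - 1 - k \<notin> U} = {x. - 1 - x \<in> U \<and> - 1 - x \<ge> 0}" by auto
    then show ?thesis using refl[of "\<lambda>x. x \<in> U \<and> x \<ge> 0"] by (simp add: Int_def)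
  qed
  moreover have "inj_on (\<lambda>x::int. - 1 - x) S" for S by (auto simp: inj_on_def)
  ultimately show ?thesis by (simp add: reg_def card_image)
qed

section \<open>Charges along residue classes\<close>

definition line :: "int \<Rightarrow> int \<Rightarrow> int set \<Rightarrow> int set" where
  "line s x B = {k. x + k * s \<in> B}"

text \<open>The charge is a function of every integer \<open>x\<close>, not only of a residue: the
  base point of the line counts as position 0, so passing from \<open>x\<close> to
  \<open>x + s\<close> lowers the value by one. This drift is used throughout.\<close>

definition charge :: "int \<Rightarrow> int set \<Rightarrow> int \<Rightarrow> int" where
  "charge s B x = reg (line s x B)"

lemma maya_line:
  assumes "maya B" "s > 0" shows "maya (line s x B)"
proof -
  obtain M N where w: "window M N B" using assms(1) by (rule mayaE)
  have "x + k * s < M" if "k < - \<bar>M\<bar> - \<bar>x\<bar>" for k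
  proof -
    have "k * s \<le> k * 1" using that assms(2) by (intro mult_left_mono_neg) auto
    then show ?thesis using that by linarith
  qed
  moreover have "k < \<bar>N\<bar> + \<bar>x\<bar>" if "x + k * s < N" for k
  proof (rule ccontr)
    assume k: "\<not> ?thesis"
    then have "k * s \<ge> k * 1" using assms(2) by (intro mult_left_mono) auto
    then show False using that k by linarith
  qed
  ultimately show ?thesis
    by (intro mayaI[of "- \<bar>M\<bar> - \<bar>x\<bar>" _ "\<bar>N\<bar> + \<bar>x\<bar>"]) (auto simp: line_def intro: window_mem[OF w] dest: window_upper[OF w])
qed

lemma charge_add_multiple:
  assumes "maya B" "s > 0" shows "charge s B (x + c * s) = charge s B x - c"
proof -
  have "line s (x + c * s) B = {k. k + c \<in> line s x B}" by (auto simp: line_def algebra_simps)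
  then show ?thesis using reg_shift[OF maya_line[OF assms]] by (simp add: charge_def)
qed

lemma charge_move_bead:
  assumes "maya B" "s > 0" "b \<in> B" "y \<notin> B" "s dvd y - b"
  shows "charge s (move_bead b y B) x = charge s B x"
proof (cases "s dvd b - x")
  case True
  obtain m where m: "y - b = s * m" using assms(5) by blast
  obtain c where c: "b - x = s * c" using True by blast
  have b: "b = x + c * s" and y: "y = x + (c + m) * s" using m c by (auto simp: algebra_simps)
  have "line s x (move_bead b y B) = move_bead c (c + m) (line s x B)"
    using assms(2) unfolding line_def move_bead_def b y by auto
  moreover have "c \<in> line s x B" "c + m \<notin> line s x B"
    using assms(3,4) b y by (auto simp: line_def)
  ultimately show ?thesis unfolding charge_def using reg_move_bead maya_line assms(1,2) by metis
next
  case False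
  have "\<not> s dvd y - x" using False assms(5) by (metis diff_add_cancel dvd_add_right_iff add_diff_eq)
  then have "line s x (move_bead b y B) = line s x B"
    using False by (auto simp: line_def move_bead_def)
  then show ?thesis by (simp add: charge_def)
qed

lemma down_closed_multiple:
  fixes s :: int
  assumes "\<And>b. b \<in> B \<Longrightarrow> b - s \<in> B" "b \<in> B" "k \<ge> 0" shows "b - k * s \<in> B"
proof -
  have "b - int n * s \<in> B" for n
  proof (induction n)
    case (Suc n)
    then show ?case using assms(1)[of "b - int n * s"] by (simp add: algebra_simps)
  qed (use assms in simp)
  from this[of "nat k"] show ?thesis using assms(3) by simp
qed

lemma reg_lessThan: "reg {..<c} = c" "maya {..<c}"
proof -
  have w: "window (min 0 c) c {..<c}" by (auto simp: window_def)
  then show "maya {..<c}" by (auto simp: maya_def)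
  have "{..<c} \<inter> {min 0 c..} = {min 0 c..<c}" by auto
  then show "reg {..<c} = c" using reg_window[OF w] by simp
qed

text \<open>When beads are pushed down as far as possible, each line is a ray \<open>{..<c}\<close>
  whose regularised cardinality is its endpoint \<open>c\<close>. The point \<open>y\<close> sits at
  position 0 of its line, so it is a bead exactly when \<open>c > 0\<close>. A core can therefore be
  read off from its charges.\<close>

lemma charge_pos_iff_mem:
  assumes "maya B" "s > 0" "\<And>b. b \<in> B \<Longrightarrow> b - s \<in> B"
  shows "charge s B y > 0 \<longleftrightarrow> y \<in> B"
proof
  assume y: "y \<in> B"
  have "{..<1} \<subseteq> line s y B"
  proof
    fix k :: int assume "k \<in> {..<1}"
    then show "k \<in> line s y B" using down_closed_multiple[of B s y "- k", OF assms(3) y] by (auto simp: line_def)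
  qed
  then show "charge s B y > 0"
    using reg_mono[OF reg_lessThan(2) maya_line[OF assms(1,2)]] reg_lessThan(1)[of 1] by (force simp: charge_def)
next
  assume c: "charge s B y > 0"
  show "y \<in> B"
  proof (rule ccontr)
    assume n: "y \<notin> B"
    have "line s y B \<subseteq> {..<0}"
    proof
      fix k assume "k \<in> line s y B"
      then show "k \<in> {..<0}" using down_closed_multiple[of B s "y + k * s" k, OF assms(3)] n
        by (force simp: line_def not_less)
    qed
    then show False
      using reg_mono[OF maya_line[OF assms(1,2)] reg_lessThan(2)[of 0]] reg_lessThan(1)[of 0] c by (force simp: charge_def)
  qed
qed

section \<open>Bead sets of partitions\<close>

text \<open>The offset is chosen so that the empty partition has precisely the negative integers as
  beads, which makes \<open>reg\<close> vanish for every partition.\<close>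

definition bead :: "(nat \<Rightarrow> nat) \<Rightarrow> nat \<Rightarrow> int" where
  "bead p r = int (p r) - int r - 1"

definition beads :: "(nat \<Rightarrow> nat) \<Rightarrow> int set" where
  "beads p = range (bead p)"

lemma partition_le: "is_partition p \<Longrightarrow> r \<le> r' \<Longrightarrow> p r' \<le> p r"
  unfolding is_partition_def by (auto dest: antimonoD)

lemma partitionI:
  assumes "\<And>r. p (Suc r) \<le> p r" "\<And>r. r \<ge> n \<Longrightarrow> p r = 0" shows "is_partition p"
proof -
  have "{r. p r \<noteq> 0} \<subseteq> {..<n}" using assms(2) by (metis (mono_tags) lessThan_iff linorder_not_less mem_Collect_eq subsetI)
  then show ?thesis unfolding is_partition_def
    using finite_subset assms(1) by (auto simp: antimono_iff_le_Suc)
qed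

lemma partition_eventually_zero:
  assumes "is_partition p" obtains n where "\<And>r. r \<ge> n \<Longrightarrow> p r = 0"
proof -
  have "finite {r. p r \<noteq> 0}" using assms by (simp add: is_partition_def)
  then obtain n where "\<forall>r\<in>{r. p r \<noteq> 0}. r < n" by (meson finite_nat_set_iff_bounded)
  then show thesis using that[of n] by (auto simp: not_less[symmetric])
qed

lemma bead_strict_decreasing: "is_partition p \<Longrightarrow> r < r' \<Longrightarrow> bead p r' < bead p r"
  using partition_le[of p r r'] by (simp add: bead_def)

lemma bead_less_iff: "is_partition p \<Longrightarrow> bead p r < bead p r' \<longleftrightarrow> r' < r"
  using bead_strict_decreasing[of p] by (metis less_imp_not_less linorder_neqE_nat)

lemma bead_eq_iff: "is_partition p \<Longrightarrow> bead p r = bead p r' \<longleftrightarrow> r = r'"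
  using bead_strict_decreasing[of p] by (metis less_irrefl linorder_neqE_nat)

lemma beads_window:
  assumes "is_partition p" "\<And>r. r \<ge> n \<Longrightarrow> p r = 0"
  shows "window (- int n) (int (p 0)) (beads p)" "beads p \<inter> {- int n..} = bead p ` {..<n}"
proof -
  show "window (- int n) (int (p 0)) (beads p)"
    unfolding window_def
  proof (intro allI conjI impI)
    fix x assume "x < - int n"
    then have "x = bead p (nat (- 1 - x))" using assms(2) by (simp add: bead_def)
    then show "x \<in> beads p" by (simp add: beads_def)
  next
    fix x assume "x \<in> beads p"
    then obtain r where "x = bead p r" by (auto simp: beads_def)
    then show "x < int (p 0)" using partition_le[OF assms(1), of 0 r] by (simp add: bead_def)
  qed
  show "beads p \<inter> {- int n..} = bead p ` {..<n}"
  proof (intro equalityI subsetI)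
    fix x assume "x \<in> beads p \<inter> {- int n..}"
    then obtain r where r: "x = bead p r" "- int n \<le> x" by (auto simp: beads_def)
    then have "r < n" using assms(2)[of r] by (cases "r < n") (auto simp: bead_def)
    then show "x \<in> bead p ` {..<n}" using r by auto
  qed (auto simp: beads_def bead_def)
qed

lemma maya_beads: assumes "is_partition p" shows "maya (beads p)"
  using partition_eventually_zero[OF assms] beads_window(1)[OF assms] by (metis maya_def)

lemma reg_beads: assumes "is_partition p" shows "reg (beads p) = 0"
proof -
  obtain n where n: "\<And>r. r \<ge> n \<Longrightarrow> p r = 0" using partition_eventually_zero[OF assms] by blast
  have "inj_on (bead p) {..<n}" using bead_eq_iff[OF assms] by (auto simp: inj_on_def)
  then show ?thesis
    using reg_window[OF beads_window(1)[OF assms n]] beads_window(2)[OF assms n]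
    by (simp add: card_image)
qed

lemma beads_inj:
  assumes p: "is_partition p" and q: "is_partition q" and eq: "beads p = beads q"
  shows "p = q"
proof -
  have "bead p r = bead q r" for r
  proof (induction r rule: less_induct)
    case (less r)
    have *: "bead p' r \<le> bead q' r"
      if h: "is_partition p'" "is_partition q'" "beads p' = beads q'" "\<And>i. i < r \<Longrightarrow> bead p' i = bead q' i" for p' q'
    proof -
      obtain i where i: "bead p' r = bead q' i" using h(3) by (force simp: beads_def)
      have "r \<le> i" using h(4)[of i] i bead_eq_iff[OF h(1)] by (metis not_less less_irrefl)
      then show ?thesis using i bead_less_iff[OF h(2)] by (metis not_less)
    qed
    show ?case using *[OF p q eq] *[OF q p eq[symmetric]] less by force
  qed
  then show ?thesis by (auto simp: bead_def)
qed

text \<open>List \<open>B\<close> in decreasing order as \<open>e 0, e 1, ...\<close> and read off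
  the parts \<open>e r + r + 1\<close>. These decrease weakly because \<open>e\<close> decreases
  strictly; \<open>reg B = 0\<close> is what makes them eventually zero.\<close>

lemma ex_partition_beads:
  assumes "maya B" "reg B = 0" obtains p where "is_partition p" "beads p = B"
proof -
  obtain M N where w: "M \<le> 0" "window M N B" using maya_common_window[OF assms(1,1)] by blast
  \<comment> \<open>Reflecting \<open>B\<close> at its upper bound gives a set of naturals, so that
    \<open>enumerate\<close> in increasing order lists the beads in decreasing order.\<close>
  define S where "S = {n::nat. N - 1 - int n \<in> B}"
  have inf: "infinite S"
  proof -
    have "n \<in> S" if "n \<ge> nat (N - M)" for n
      using window_mem[OF w(2)] that by (auto simp: S_def)
    then have "{nat (N - M)..} \<subseteq> S" by auto
    then show ?thesis using infinite_Ici infinite_super by blast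
  qed
  define e where "e r = N - 1 - int (enumerate S r)" for r
  have range_e: "range e = B"
  proof (intro equalityI subsetI)
    fix x assume "x \<in> range e"
    then show "x \<in> B" using enumerate_in_set[OF inf] by (auto simp: e_def S_def)
  next
    fix x assume x: "x \<in> B"
    have "x < N" using window_upper[OF w(2) x] .
    then have "int (nat (N - 1 - x)) = N - 1 - x" by simp
    then have "nat (N - 1 - x) \<in> S" unfolding S_def mem_Collect_eq using x by simp
    then obtain r where "enumerate S r = nat (N - 1 - x)" using enumerate_Ex[OF inf] by blast
    then have "e r = x" using \<open>x < N\<close> by (simp add: e_def)
    then show "x \<in> range e" by blast
  qed
  have dec: "e (Suc r) < e r" for r using enumerate_step[OF inf, of r] by (simp add: e_def)
  then have anti: "e r' < e r" if "r < r'" for r r' using lift_Suc_mono_less[of "\<lambda>r. - e r" r r'] that by simp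
  \<comment> \<open>If \<open>-1 - r\<close> is the bead with index \<open>i\<close>, there are
    \<open>i + 1\<close> beads from there upwards; zero charge says that this number is
    \<open>r + 1\<close>.\<close>
  have ev: "e r = - 1 - int r" if r: "int r \<ge> - M" for r
  proof -
    have "- 1 - int r \<in> B" using window_mem[OF w(2)] r by simp
    then obtain i where i: "e i = - 1 - int r" using range_e by (metis image_iff)
    have w': "window (- 1 - int r) N B" using window_weaken[OF w(2)] r by simp
    have "B \<inter> {- 1 - int r..} = e ` {..i}"
    proof (intro equalityI subsetI)
      fix x assume x: "x \<in> B \<inter> {- 1 - int r..}"
      then obtain j where j: "x = e j" using range_e by blast
      have "\<not> i < j" using anti[of i j] x j i by auto
      then show "x \<in> e ` {..i}" using j by auto
    next
      fix x assume "x \<in> e ` {..i}"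
      then obtain j where "x = e j" "j \<le> i" by auto
      moreover have "e j \<in> B" using range_e by blast
      ultimately show "x \<in> B \<inter> {- 1 - int r..}" using anti[of j i] i by (cases "j = i") auto
    qed
    moreover have "inj_on e {..i}" using anti by (metis inj_onI less_irrefl linorder_neqE_nat)
    ultimately have "int (Suc i) = int r + 1"
      using reg_window[OF w'] assms(2) by (simp add: card_image)
    then show ?thesis using i by simp
  qed
  have mono: "e (Suc r) + int (Suc r) + 1 \<le> e r + int r + 1" for r using dec[of r] by simp
  have ge: "e r + int r + 1 \<ge> 0" for r
  proof -
    let ?r' = "r + nat (- M)"
    have "antimono (\<lambda>r. e r + int r + 1)" unfolding antimono_iff_le_Suc using mono by simp
    then have "e ?r' + int ?r' + 1 \<le> e r + int r + 1" by (rule antimonoD) simp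
    moreover have "e ?r' + int ?r' + 1 = 0" using ev[of ?r'] by auto
    ultimately show ?thesis by linarith
  qed
  define p where "p r = nat (e r + int r + 1)" for r
  have "is_partition p"
  proof (rule partitionI[of _ "nat (- M)"])
    show "p (Suc r) \<le> p r" for r using mono[of r] by (simp add: p_def)
    show "p r = 0" if "r \<ge> nat (- M)" for r using ev[of r] that by (simp add: p_def)
  qed
  moreover have "bead p r = e r" for r using ge[of r] by (simp add: bead_def p_def)
  then have "beads p = B" using range_e by (simp add: beads_def)
  ultimately show thesis using that by blast
qed

section \<open>Conjugation and size in terms of beads\<close>

lemma partition_conjugate:
  assumes "is_partition p" shows "is_partition (conjugate p)"
proof (rule partitionI[of _ "p 0"])
  fix r
  have "{i. (i, Suc r) \<in> diagram p} \<subseteq> {i. (i, r) \<in> diagram p}" by (auto simp: diagram_def)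
  then show "conjugate p (Suc r) \<le> conjugate p r"
    unfolding conjugate_def using finite_column[OF assms, of r] by (auto simp: diagram_def intro: card_mono)
next
  fix r assume "p 0 \<le> r"
  then have "{i. (i, r) \<in> diagram p} = {}"
    using partition_le[OF assms, of 0] by (auto simp: diagram_def not_less intro: order_trans)
  then show "conjugate p r = 0" unfolding conjugate_def by simp
qed

lemma less_conjugate_iff: "is_partition p \<Longrightarrow> r < conjugate p c \<longleftrightarrow> c < p r"
  using diagram_conjugate[of p] by (auto simp: diagram_def set_eq_iff)

text \<open>Only one inclusion is checked on the diagram: no bead of the conjugate is the reflection
  of a bead of \<open>p\<close>. Both sides have regularised cardinality 0, so the inclusion cannot
  be proper.\<close>

lemma beads_conjugate:
  assumes p: "is_partition p" shows "beads (conjugate p) = {x. - 1 - x \<notin> beads p}"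
proof (rule ccontr)
  assume ne: "beads (conjugate p) \<noteq> {x. - 1 - x \<notin> beads p}"
  have "- 1 - bead (conjugate p) c \<noteq> bead p r" for c r
    using less_conjugate_iff[OF p, of r c] by (auto simp: bead_def)
  then have "beads (conjugate p) \<subset> {x. - 1 - x \<notin> beads p}" using ne by (auto simp: beads_def)
  then have "reg (beads (conjugate p)) < reg {x. - 1 - x \<notin> beads p}"
    using reg_strict_mono maya_reflect maya_beads p partition_conjugate by blast
  then show False by (simp add: reg_reflect reg_beads p partition_conjugate)
qed

lemma diagram_Sigma: "diagram p = Sigma {r. p r \<noteq> 0} (\<lambda>r. {..<p r})"
  by (auto simp: diagram_def)

lemma finite_diagram: "is_partition p \<Longrightarrow> finite (diagram p)"
  unfolding diagram_Sigma is_partition_def by auto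

lemma psize_card_diagram: "is_partition p \<Longrightarrow> psize p = card (diagram p)"
  unfolding diagram_Sigma psize_def is_partition_def by simp

lemma psize_conjugate: assumes "is_partition p" shows "psize (conjugate p) = psize p"
proof -
  have "diagram (conjugate p) = prod.swap ` diagram p" using diagram_conjugate[OF assms] by force
  then show ?thesis by (simp add: psize_card_diagram assms partition_conjugate card_image)
qed

lemma psize_eq_bead_sum:
  assumes p: "is_partition p" and n: "\<And>r. r \<ge> n \<Longrightarrow> p r = 0"
  shows "int (psize p) = \<Sum>(beads p \<inter> {- int n..}) + (\<Sum>r<n. int r + 1)"
proof -
  have "psize p = (\<Sum>r<n. p r)" unfolding psize_def
  proof (rule sum.mono_neutral_left)
    show "{r. p r \<noteq> 0} \<subseteq> {..<n}" using n not_less by auto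
  qed auto
  then have "int (psize p) = (\<Sum>r<n. bead p r) + (\<Sum>r<n. int r + 1)"
    by (simp add: bead_def sum.distrib[symmetric])
  also have "(\<Sum>r<n. bead p r) = \<Sum>(bead p ` {..<n})"
    by (subst sum.reindex) (use bead_eq_iff[OF p] in \<open>auto simp: inj_on_def\<close>)
  finally show ?thesis using beads_window(2)[OF p n] by simp
qed

lemma psize_diff:
  assumes p: "is_partition p" and q: "is_partition q"
  shows "int (psize q) - int (psize p) = \<Sum>(beads q - beads p) - \<Sum>(beads p - beads q)"
proof -
  obtain n1 n2 where n1: "\<And>r. r \<ge> n1 \<Longrightarrow> p r = 0" and n2: "\<And>r. r \<ge> n2 \<Longrightarrow> q r = 0"
    using partition_eventually_zero p q by metis
  define n where "n = max n1 n2"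
  have np: "\<And>r. r \<ge> n \<Longrightarrow> p r = 0" and nq: "\<And>r. r \<ge> n \<Longrightarrow> q r = 0" using n1 n2 by (auto simp: n_def)
  let ?I = "beads p \<inter> beads q \<inter> {- int n..}"
  note wp = beads_window[OF p np] and wq = beads_window[OF q nq]
  have fin: "finite (beads p - beads q)" "finite (beads q - beads p)"
    using maya_finite_diff maya_beads p q by blast+
  have fI: "finite ?I" by (rule finite_subset[of _ "beads p \<inter> {- int n..}"]) (use wp(2) in auto)
  have P: "beads p \<inter> {- int n..} = ?I \<union> (beads p - beads q)"
    and Q: "beads q \<inter> {- int n..} = ?I \<union> (beads q - beads p)"
    by (auto intro: window_lower[OF wp(1)] window_lower[OF wq(1)])
  have "\<Sum>(beads p \<inter> {- int n..}) = \<Sum>?I + \<Sum>(beads p - beads q)"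
    "\<Sum>(beads q \<inter> {- int n..}) = \<Sum>?I + \<Sum>(beads q - beads p)"
    unfolding P Q by (rule sum.union_disjoint; use fI fin in auto)+
  then show ?thesis using psize_eq_bead_sum[OF p np] psize_eq_bead_sum[OF q nq] by simp
qed

lemma psize_move_bead:
  assumes "is_partition p" "is_partition q" "b \<in> beads p" "y \<notin> beads p" "beads q = move_bead b y (beads p)"
  shows "int (psize q) = int (psize p) + y - b"
proof -
  have "beads q - beads p = {y}" "beads p - beads q = {b}" using assms(3-5) by (auto simp: move_bead_def)
  then show ?thesis using psize_diff[OF assms(1,2)] by simp
qed

lemma ex_partition_move_bead:
  assumes "is_partition p" "b \<in> beads p" "y \<notin> beads p"
  obtains q where "is_partition q" "beads q = move_bead b y (beads p)" "int (psize q) = int (psize p) + y - b"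
proof -
  obtain q where "is_partition q" "beads q = move_bead b y (beads p)"
    using ex_partition_beads[of "move_bead b y (beads p)"] maya_move_bead maya_beads[OF assms(1)]
      reg_move_bead[OF maya_beads assms(2,3)] reg_beads assms(1) by metis
  then show thesis using that psize_move_bead assms by metis
qed

text \<open>Stripping a ribbon from rows \<open>r1\<close> to \<open>r2\<close> gives each row but
  the last the bead of the row below it. The bead list is thus shifted by one place, so a single
  bead is lost at the top and a single one gained at the bottom.\<close>

lemma beads_row_shift:
  assumes p: "is_partition p" and q: "is_partition q" and r: "r1 \<le> r2"
    and out: "\<And>r. r < r1 \<or> r2 < r \<Longrightarrow> q r = p r"
    and inside: "\<And>r. r1 \<le> r \<Longrightarrow> r < r2 \<Longrightarrow> bead q r = bead p (Suc r)"
    and less: "bead q r2 < bead p r1"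
  shows "beads q = move_bead (bead p r1) (bead q r2) (beads p)" "bead q r2 \<notin> beads p"
proof -
  have o: "bead q r = bead p r" if "r < r1 \<or> r2 < r" for r using out[OF that] by (simp add: bead_def)
  have sh: "bead p r \<in> bead q ` (- {r2})" if "r \<noteq> r1" for r
  proof (cases "r < r1 \<or> r2 < r")
    case True
    then show ?thesis using o[OF True] r by (intro image_eqI[of _ _ r]) auto
  next
    case False
    then have "r1 \<le> r - 1" "r - 1 < r2" "Suc (r - 1) = r" using that by auto
    then show ?thesis using inside[of "r - 1"] by (intro image_eqI[of _ _ "r - 1"]) auto
  qed
  show nin: "bead q r2 \<notin> beads p"
  proof
    assume "bead q r2 \<in> beads p"
    then obtain r where r: "bead q r2 = bead p r" by (auto simp: beads_def)
    then have "r \<noteq> r1" using less by auto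
    from sh[OF this] show False using r bead_eq_iff[OF q] by auto
  qed
  show "beads q = move_bead (bead p r1) (bead q r2) (beads p)"
  proof (intro equalityI subsetI)
    fix x assume "x \<in> beads q"
    then obtain i where i: "x = bead q i" by (auto simp: beads_def)
    consider "i < r1 \<or> r2 < i" | "r1 \<le> i" "i < r2" | "i = r2" by linarith
    then show "x \<in> move_bead (bead p r1) (bead q r2) (beads p)"
    proof cases
      case 1
      then have "i \<noteq> r1" using r by auto
      then show ?thesis using i o[OF 1] bead_eq_iff[OF p] by (auto simp: move_bead_def beads_def)
    next
      case 2
      then show ?thesis using i inside[OF 2] bead_eq_iff[OF p] by (auto simp: move_bead_def beads_def)
    qed (use i in \<open>auto simp: move_bead_def\<close>)
  next
    fix x assume "x \<in> move_bead (bead p r1) (bead q r2) (beads p)"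
    then consider "x = bead q r2" | i where "x = bead p i" "i \<noteq> r1" by (auto simp: move_bead_def beads_def)
    then show "x \<in> beads q" using sh by cases (auto simp: beads_def)
  qed
qed

section \<open>Rim hooks, cores and weights\<close>

lemma rtrancl_crossing:
  assumes "(x, y) \<in> R\<^sup>*" "P x" "\<not> P y"
  obtains u v where "(u, v) \<in> R" "P u" "\<not> P v"
proof -
  have "\<exists>u v. (u, v) \<in> R \<and> P u \<and> \<not> P v" using assms by (induction rule: rtrancl_induct) blast+
  then show thesis using that by blast
qed

text \<open>Let \<open>r1\<close> and \<open>r2\<close> be the extreme rows of the hook.
  Connectedness and the rim condition pin down all rows of \<open>q\<close> between them, which
  yields the situation of \<open>beads_row_shift\<close>.\<close>

lemma rim_hook_move_bead:
  assumes p: "is_partition p" and q: "is_partition q" and hook: "rim_hook s p H" and s: "s > 0"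
    and d: "diagram q = diagram p - H"
  obtains b where "b \<in> beads p" "b - int s \<notin> beads p" "beads q = move_bead b (b - int s) (beads p)"
proof -
  have Hrim: "H \<subseteq> rim p" and Hcard: "card H = s" and conn: "connected_nodes H"
    using hook by (auto simp: rim_hook_def)
  have Hd: "H \<subseteq> diagram p" using Hrim by (auto simp: rim_def)
  have fH: "finite H" using Hd finite_diagram[OF p] finite_subset by blast
  have mem: "(r, c) \<in> H \<longleftrightarrow> q r \<le> c \<and> c < p r" for r c
  proof -
    have "(r, c) \<in> diagram q \<longleftrightarrow> (r, c) \<in> diagram p \<and> (r, c) \<notin> H" using d by blast
    then show ?thesis using Hd by (auto simp: diagram_def not_less)
  qed
  have sub: "q r \<le> p r" for r
  proof (rule ccontr)
    assume "\<not> q r \<le> p r"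
    then have "(r, p r) \<in> diagram q" by (simp add: diagram_def)
    moreover have "(r, p r) \<notin> diagram p" by (simp add: diagram_def)
    ultimately show False using d by blast
  qed
  define r1 where "r1 = Min (fst ` H)"
  define r2 where "r2 = Max (fst ` H)"
  have ne: "fst ` H \<noteq> {}" using Hcard s by auto
  have r1: "r1 \<in> fst ` H" and r2: "r2 \<in> fst ` H"
    unfolding r1_def r2_def using ne fH by (auto simp del: image_is_empty)
  have between: "r1 \<le> r" "r \<le> r2" if "r \<in> fst ` H" for r
    unfolding r1_def r2_def using that fH by auto
  have out: "q r = p r" if "r < r1 \<or> r2 < r" for r
  proof (rule ccontr)
    assume "q r \<noteq> p r"
    then have "(r, q r) \<in> H" using mem sub[of r] by simp
    then show False using between[of r] that by force
  qed
  \<comment> \<open>A path in \<open>H\<close> from row \<open>r1\<close> to row \<open>r2\<close>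
    must descend from row \<open>r\<close> to the next somewhere, so the two rows share a column of
    \<open>H\<close>, giving one inequality. The other holds because the first removed node of row
    \<open>r\<close> lies on the rim.\<close>
  have step: "q r + 1 = p (Suc r)" if r: "r1 \<le> r" "r < r2" for r
  proof -
    obtain x y where xy: "x \<in> H" "y \<in> H" "fst x = r1" "fst y = r2" using r1 r2 by force
    then have path: "(x, y) \<in> {(u, v). u \<in> H \<and> v \<in> H \<and> adjacent u v}\<^sup>*"
      using conn by (simp add: connected_nodes_def)
    obtain u v where uv: "u \<in> H" "v \<in> H" "adjacent u v" "fst u \<le> r" "\<not> fst v \<le> r"
      by (rule rtrancl_crossing[OF path, of "\<lambda>u. fst u \<le> r"]) (use xy r in auto)
    then have "fst u = r" "fst v = Suc r" "snd u = snd v" by (auto simp: adjacent_def)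
    then have "(r, snd u) \<in> H" "(Suc r, snd u) \<in> H" using uv(1,2) by (metis prod.collapse)+
    then have 1: "q r \<le> snd u" "snd u < p r" "snd u < p (Suc r)" using mem by auto
    then have "(r, q r) \<in> rim p" using mem Hrim by auto
    then show ?thesis using 1 by (auto simp: rim_def diagram_def)
  qed
  have le: "r1 \<le> r2" using between r1 by blast
  have "q r2 < p r2"
  proof -
    obtain c where "(r2, c) \<in> H" using r2 by force
    then show ?thesis using mem[of r2 c] by linarith
  qed
  then have less: "bead q r2 < bead p r1" using partition_le[OF p le] le by (simp add: bead_def)
  have inside: "bead q r = bead p (Suc r)" if "r1 \<le> r" "r < r2" for r
    using step[OF that] by (simp add: bead_def)
  note sh = beads_row_shift[OF p q le out inside less]
  \<comment> \<open>The landing place of the bead follows from sizes: the diagram loses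
    \<open>s\<close> nodes, and the size changes by the displacement of the bead.\<close>
  have "card (diagram q) = card (diagram p) - s" using Hcard d card_Diff_subset[OF fH Hd] by simp
  moreover have "s \<le> card (diagram p)" using Hcard card_mono[OF finite_diagram[OF p] Hd] by simp
  moreover have "int (psize q) = int (psize p) + bead q r2 - bead p r1"
    using psize_move_bead[OF p q _ sh(2,1)] by (simp add: beads_def)
  ultimately have "bead q r2 = bead p r1 - int s" by (simp add: psize_card_diagram p q)
  then show thesis using that[of "bead p r1"] sh by (simp add: beads_def)
qed

text \<open>Every node is joined to the leftmost node of the bottom row: go left to the start of the
  row, step down, which stays in \<open>H\<close> by the overlap condition, and repeat.\<close>

lemma connected_nodes_ribbon:
  assumes mem: "\<And>r c. (r, c) \<in> H \<longleftrightarrow> r1 \<le> r \<and> r \<le> r2 \<and> q r \<le> c \<and> c < p r"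
    and overlap: "\<And>r. r1 \<le> r \<Longrightarrow> r < r2 \<Longrightarrow> q (Suc r) \<le> q r \<and> q r < p (Suc r) \<and> q r < p r"
  shows "connected_nodes H"
proof -
  let ?R = "{(u, v). u \<in> H \<and> v \<in> H \<and> adjacent u v}"
  have left: "((r, c), (r, q r)) \<in> ?R\<^sup>*" if "(r, c) \<in> H" for r c
    using that
  proof (induction c)
    case 0
    then show ?case using mem by auto
  next
    case (Suc c)
    show ?case
    proof (cases "q r = Suc c")
      case False
      then have c: "(r, c) \<in> H" using Suc.prems mem by auto
      then have "((r, Suc c), (r, c)) \<in> ?R" using Suc.prems by (simp add: adjacent_def)
      then show ?thesis using Suc.IH[OF c] by (rule converse_rtrancl_into_rtrancl)
    qed simp
  qed
  have down: "((r, q r), (r2, q r2)) \<in> ?R\<^sup>*" if "r1 \<le> r" "r \<le> r2" for r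
    using that(2,1)
  proof (induction r rule: inc_induct)
    case (step n)
    have o: "q (Suc n) \<le> q n" "q n < p (Suc n)" "q n < p n" using overlap[of n] step by auto
    have "(n, q n) \<in> H" "(Suc n, q n) \<in> H" using mem o step by auto
    then have "((n, q n), (Suc n, q n)) \<in> ?R" "((Suc n, q n), (Suc n, q (Suc n))) \<in> ?R\<^sup>*"
      using left by (auto simp: adjacent_def)
    then show ?case using step by (meson converse_rtrancl_into_rtrancl le_SucI rtrancl_trans)
  qed simp
  have to: "(x, (r2, q r2)) \<in> ?R\<^sup>*" if x: "x \<in> H" for x
    using left[of "fst x" "snd x"] down[of "fst x"] mem[of "fst x" "snd x"] x by simp
  have "sym ?R" by (auto simp: sym_def adjacent_def)
  then have "sym (?R\<^sup>*)" by (rule sym_rtrancl)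
  then show ?thesis unfolding connected_nodes_def using to by (meson rtrancl_trans symD)
qed

text \<open>Converse construction: the bead \<open>b\<close> of row \<open>r1\<close> jumps over the
  beads of the rows up to \<open>r2\<close>, the last row whose bead exceeds \<open>b - s\<close>.
  Shifting these rows up by one and shortening them by one node leaves a partition, and the
  difference of the diagrams is the hook.\<close>

lemma move_bead_rim_hook:
  assumes p: "is_partition p" and s: "s > 0" and b: "b \<in> beads p" and bs: "b - int s \<notin> beads p"
  shows "\<exists>H. rim_hook s p H"
proof -
  obtain r1 where r1: "b = bead p r1" using b by (auto simp: beads_def)
  let ?R = "{r. bead p r > b - int s}"
  have R: "?R \<subseteq> {..<nat (int (p 0) - (b - int s))}"
  proof
    fix r assume "r \<in> ?R"
    then show "r \<in> {..<nat (int (p 0) - (b - int s))}" using partition_le[OF p, of 0 r] by (simp add: bead_def)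
  qed
  then have fR: "finite ?R" using finite_subset by blast
  have r1R: "r1 \<in> ?R" using s r1 by simp
  define r2 where "r2 = Max ?R"
  have r2R: "r2 \<in> ?R" unfolding r2_def using fR r1R by (metis Max_in empty_iff)
  have le: "r1 \<le> r2" unfolding r2_def using fR r1R by simp
  have "Suc r2 \<notin> ?R" unfolding r2_def using fR Max_ge Suc_n_not_le_n by blast
  moreover have "bead p (Suc r2) \<noteq> b - int s" using bs unfolding beads_def by (metis rangeI)
  ultimately have below: "bead p (Suc r2) < b - int s" by simp
  \<comment> \<open>The new length of row \<open>r2\<close>, chosen so that its bead becomes
    \<open>b - s\<close>.\<close>
  define m where "m = nat (b - int s + int r2 + 1)"
  have m: "int m = b - int s + int r2 + 1" using below by (simp add: m_def bead_def)
  have pm: "p (Suc r2) \<le> m" using below m by (simp add: bead_def)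
  have mp: "m < p r2" using r2R m by (simp add: bead_def)
  have ppos: "p r > 0" if "r \<le> r2" for r using partition_le[OF p that] mp by simp
  define q where "q r = (if r < r1 \<or> r2 < r then p r else if r < r2 then p (Suc r) - 1 else m)" for r
  have qle: "q r \<le> p r" for r
  proof -
    have "p (Suc r) \<le> p r" using partition_le[OF p, of r "Suc r"] by simp
    moreover have "r = r2" if "\<not> r < r2" "\<not> r2 < r" using that by simp
    ultimately show ?thesis using mp unfolding q_def by auto
  qed
  obtain n where n: "\<And>r. r \<ge> n \<Longrightarrow> p r = 0" using partition_eventually_zero[OF p] by blast
  have q: "is_partition q"
  proof (rule partitionI[of _ n])
    fix r
    have pS: "p (Suc r) \<le> p r" "p (Suc (Suc r)) \<le> p (Suc r)" using partition_le[OF p] by simp_all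
    consider "r < r1 \<or> r2 < r" | "r1 \<le> r" "r < r2" "Suc r < r2" | "r1 \<le> r" "Suc r = r2" | "r = r2" using le by linarith
    then show "q (Suc r) \<le> q r"
    proof cases
      case 1
      then have "q r = p r" by (simp add: q_def)
      then show ?thesis using qle[of "Suc r"] pS by simp
    qed (use pS mp pm le in \<open>auto simp: q_def\<close>)
  next
    show "q r = 0" if "r \<ge> n" for r using n[OF that] qle[of r] by simp
  qed
  define H where "H = diagram p - diagram q"
  have dq: "diagram q = diagram p - H" unfolding H_def using qle by (auto simp: diagram_def intro: less_le_trans)
  have mem: "(r, c) \<in> H \<longleftrightarrow> r1 \<le> r \<and> r \<le> r2 \<and> q r \<le> c \<and> c < p r" for r c
    by (auto simp: H_def diagram_def not_less q_def)
  have insd: "q r + 1 = p (Suc r)" if "r1 \<le> r" "r < r2" for r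
    using that ppos[of "Suc r"] by (simp add: q_def)
  have qr2: "q r2 = m" using le by (simp add: q_def)
  have "H \<subseteq> rim p"
  proof
    fix x assume "x \<in> H"
    then obtain r c where x: "x = (r, c)" "(r, c) \<in> H" by (cases x) auto
    then have rc: "r1 \<le> r" "r \<le> r2" "q r \<le> c" "c < p r" using mem by auto
    have "p (Suc r) \<le> c + 1"
    proof (cases "r = r2")
      case True
      then show ?thesis using rc qr2 pm by simp
    next
      case False
      then show ?thesis using insd[of r] rc by simp
    qed
    then show "x \<in> rim p" using x rc by (simp add: rim_def diagram_def)
  qed
  moreover have "connected_nodes H"
  proof (rule connected_nodes_ribbon[of H r1 r2 q p, OF mem])
    fix r assume r: "r1 \<le> r" "r < r2"
    show "q (Suc r) \<le> q r \<and> q r < p (Suc r) \<and> q r < p r"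
      using insd[OF r] partition_le[OF q, of r "Suc r"] partition_le[OF p, of r "Suc r"] by simp
  qed
  moreover have "card H = s"
  proof -
    have bq: "bead q r2 = b - int s" using qr2 m by (simp add: bead_def)
    have out: "q r = p r" if "r < r1 \<or> r2 < r" for r using that by (auto simp: q_def)
    have ins: "bead q r = bead p (Suc r)" if "r1 \<le> r" "r < r2" for r
      using insd[OF that] by (simp add: bead_def)
    have "bead q r2 < bead p r1" using bq s r1 by simp
    note sh = beads_row_shift[OF p q le out ins this]
    have "int (psize q) = int (psize p) + bead q r2 - bead p r1"
      using psize_move_bead[OF p q _ sh(2,1)] by (simp add: beads_def)
    then have "int (psize q) = int (psize p) - int s" using bq r1 by simp
    moreover have sub: "diagram q \<subseteq> diagram p" using dq by blast
    have "card H = card (diagram p) - card (diagram q)"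
      unfolding H_def using card_Diff_subset[OF finite_diagram[OF q] sub] .
    ultimately show ?thesis by (simp add: psize_card_diagram p q)
  qed
  ultimately show ?thesis unfolding rim_hook_def using q dq by blast
qed

section \<open>The weight as a number of inversions\<close>

definition inversions :: "int \<Rightarrow> int set \<Rightarrow> (int \<times> int) set" where
  "inversions s B = {(b, c). b \<in> B \<and> c \<notin> B \<and> c < b \<and> s dvd b - c}"

lemma finite_inversions: assumes "maya B" shows "finite (inversions s B)"
proof -
  obtain M N where w: "window M N B" using assms by (rule mayaE)
  have "inversions s B \<subseteq> {M..<N} \<times> {M..<N}"
    by (auto simp: inversions_def dest!: window_lower[OF w] window_upper[OF w])
  then show ?thesis using finite_subset by blast
qed

text \<open>Transposing \<open>b\<close> and \<open>b - s\<close> carries the inversions of the old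
  set to those of the new one. No integer congruent to \<open>b\<close> lies strictly between the
  two, so only the pair \<open>(b, b - s)\<close> itself changes its order.\<close>

lemma card_inversions_move_bead:
  assumes B: "maya B" and s: "s > 0" and b: "b \<in> B" "b - s \<notin> B"
  shows "card (inversions s B) = Suc (card (inversions s (move_bead b (b - s) B)))"
proof -
  define tr where "tr x = (if x = b then b - s else if x = b - s then b else x)" for x
  have trtr: "tr (tr x) = x" for x by (simp add: tr_def)
  have mem: "x \<in> move_bead b (b - s) B \<longleftrightarrow> tr x \<in> B" for x
    using s b by (auto simp: move_bead_def tr_def)
  have gap: "x \<le> - s" if "s dvd x" "x < 0" for x
    using zdvd_imp_le[of s "- x"] that by simp
  have dvd: "s dvd tr x - tr y \<longleftrightarrow> s dvd x - y" for x y
  proof -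
    have "s dvd tr x - x" for x by (auto simp: tr_def)
    from this[of x] this[of y] have "s dvd (tr x - x) - (tr y - y)" by (rule dvd_diff)
    moreover have "tr x - tr y = (x - y) + ((tr x - x) - (tr y - y))" by simp
    ultimately show ?thesis by (metis dvd_add_left_iff)
  qed
  let ?f = "\<lambda>(x, y). (tr x, tr y)"
  have "bij_betw ?f (inversions s B - {(b, b - s)}) (inversions s (move_bead b (b - s) B))"
  proof (rule bij_betw_byWitness[where f' = ?f])
    show "?f ` (inversions s B - {(b, b - s)}) \<subseteq> inversions s (move_bead b (b - s) B)"
    proof (clarsimp simp: inversions_def mem trtr dvd)
      fix x y assume h: "x \<in> B" "y \<notin> B" "y < x" "s dvd x - y" "x = b \<longrightarrow> y \<noteq> b - s"
      have "x = b \<Longrightarrow> y < b - s" using gap[of "y - x"] h by (auto simp: dvd_diff_commute)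
      moreover have "y = b - s \<Longrightarrow> b < x" using gap[of "y - x"] h by (auto simp: dvd_diff_commute)
      ultimately show "tr y < tr x" using h b s by (auto simp: tr_def)
    qed
    show "?f ` inversions s (move_bead b (b - s) B) \<subseteq> inversions s B - {(b, b - s)}"
    proof (clarsimp simp: inversions_def mem trtr dvd)
      fix x y assume h: "tr x \<in> B" "tr y \<notin> B" "y < x" "s dvd x - y"
      have "x \<noteq> b" "y \<noteq> b - s" using h b s by (auto simp: tr_def split: if_splits)
      then show "tr y < tr x \<and> (tr x = b \<longrightarrow> tr y \<noteq> b - s)"
        using h s by (auto simp: tr_def split: if_splits)
    qed
  qed (auto simp: trtr)
  then have "card (inversions s B - {(b, b - s)}) = card (inversions s (move_bead b (b - s) B))"
    by (rule bij_betw_same_card)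
  moreover have "(b, b - s) \<in> inversions s B" using b s by (simp add: inversions_def)
  ultimately show ?thesis using finite_inversions[OF B] by (metis card_Suc_Diff1)
qed

lemma remove_rim_hook_invariants:
  assumes "is_partition p" "s > 0" "remove_rim_hook s p q"
  shows "is_partition q" "charge (int s) (beads q) = charge (int s) (beads p)"
    "psize p = psize q + s"
    "card (inversions (int s) (beads p)) = Suc (card (inversions (int s) (beads q)))"
proof -
  obtain H where q: "is_partition q" and H: "rim_hook s p H" "diagram q = diagram p - H"
    using assms(3) by (auto simp: remove_rim_hook_def)
  obtain b where b: "b \<in> beads p" "b - int s \<notin> beads p" "beads q = move_bead b (b - int s) (beads p)"
    using rim_hook_move_bead[OF assms(1) q H(1) assms(2) H(2)] .
  note m = maya_beads[OF assms(1)]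
  show "is_partition q" by fact
  show "charge (int s) (beads q) = charge (int s) (beads p)"
    unfolding b(3) using charge_move_bead[OF m _ b(1,2)] assms(2) by auto
  show "psize p = psize q + s" using psize_move_bead[OF assms(1) q b] by simp
  show "card (inversions (int s) (beads p)) = Suc (card (inversions (int s) (beads q)))"
    unfolding b(3) using card_inversions_move_bead[OF m _ b(1,2)] assms(2) by simp
qed

lemma relpowp_remove_rim_hook_invariants:
  assumes "is_partition p" "s > 0" "(remove_rim_hook s ^^ w) p q"
  shows "is_partition q \<and> charge (int s) (beads q) = charge (int s) (beads p) \<and> psize p = psize q + s * w \<and>
    card (inversions (int s) (beads p)) = w + card (inversions (int s) (beads q))"
  using assms(3)
proof (induction w arbitrary: q)
  case 0
  then show ?case using assms by simp
next
  case (Suc w)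
  then obtain q' where q': "(remove_rim_hook s ^^ w) p q'" "remove_rim_hook s q' q" by auto
  then show ?case using Suc.IH[OF q'(1)] remove_rim_hook_invariants[OF _ assms(2) q'(2)] by simp
qed

text \<open>A bead set closed under subtracting \<open>s\<close> has no inversions, so the
  inversions of \<open>p\<close> count the removed hooks however they were chosen. Together with the
  invariance of charges this makes core and weight well defined.\<close>

lemma reduces_to_core_invariants:
  assumes p: "is_partition p" and s: "s > 0" and red: "reduces_to_core s p w q"
  shows "is_partition q" "charge (int s) (beads q) = charge (int s) (beads p)" "psize p = psize q + s * w"
    "\<And>b. b \<in> beads q \<Longrightarrow> b - int s \<in> beads q" "card (inversions (int s) (beads p)) = w"
proof -
  note inv = relpowp_remove_rim_hook_invariants[OF p s, of w q]
  show q: "is_partition q" "charge (int s) (beads q) = charge (int s) (beads p)" "psize p = psize q + s * w"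
    using inv red by (auto simp: reduces_to_core_def)
  show cl: "b - int s \<in> beads q" if "b \<in> beads q" for b
    using move_bead_rim_hook[OF q(1) s that] red by (auto simp: reduces_to_core_def)
  have "inversions (int s) (beads q) = {}"
  proof (rule ccontr)
    assume "inversions (int s) (beads q) \<noteq> {}"
    then obtain x y where h: "x \<in> beads q" "y \<notin> beads q" "y < x" "int s dvd x - y"
      by (auto simp: inversions_def)
    then obtain k where k: "x - y = int s * k" by blast
    then have "k \<ge> 0" using h(3) s by (metis diff_gt_0_iff_gt less_eq_int_code(1) linorder_not_less mult_pos_neg of_nat_0_less_iff order_less_imp_le)
    from down_closed_multiple[of "beads q" "int s" x k, OF cl h(1) this] show False
      using k h(2) by (simp add: algebra_simps)
  qed
  then show "card (inversions (int s) (beads p)) = w" using inv red by (auto simp: reduces_to_core_def)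
qed

lemma beads_reduces_to_core:
  assumes "is_partition p" "s > 0" "reduces_to_core s p w q"
  shows "beads q = {y. charge (int s) (beads p) y > 0}"
  using charge_pos_iff_mem[OF maya_beads, of q "int s"] reduces_to_core_invariants[OF assms] assms(2) by auto

lemma ex_reduces_to_core:
  assumes "is_partition p" "s > 0" shows "\<exists>w q. reduces_to_core s p w q"
  using assms(1)
proof (induction "psize p" arbitrary: p rule: less_induct)
  case less
  show ?case
  proof (cases "\<exists>H. rim_hook s p H")
    case False
    then have "reduces_to_core s p 0 p" by (simp add: reduces_to_core_def)
    then show ?thesis by blast
  next
    case True
    then obtain p' where p': "remove_rim_hook s p p'" by (auto simp: rim_hook_def remove_rim_hook_def)
    note inv = remove_rim_hook_invariants[OF less.prems assms(2) p']
    obtain w q where "reduces_to_core s p' w q" using less.hyps[of p'] inv assms(2) by auto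
    then have "reduces_to_core s p (Suc w) q"
      using relpowp_Suc_I2[of "remove_rim_hook s", OF p'] by (auto simp: reduces_to_core_def)
    then show ?thesis by blast
  qed
qed

text \<open>Existence and uniqueness of the reduction, which give the definite descriptions in
  \<open>cor\<close> and \<open>wei\<close> their intended values.\<close>

lemma reduces_to_core_cor_wei:
  assumes "is_partition p" "s > 0" shows "reduces_to_core s p (wei s p) (cor s p)"
proof -
  obtain w q where red: "reduces_to_core s p w q" using ex_reduces_to_core[OF assms] by blast
  have uniq: "w' = w \<and> q' = q" if r: "reduces_to_core s p w' q'" for w' q'
    using reduces_to_core_invariants(5)[OF assms r] reduces_to_core_invariants(5)[OF assms red]
      beads_inj[OF reduces_to_core_invariants(1)[OF assms r] reduces_to_core_invariants(1)[OF assms red]]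
      beads_reduces_to_core[OF assms r] beads_reduces_to_core[OF assms red] by simp
  have "cor s p = q" unfolding cor_def using red uniq by blast
  moreover have "wei s p = w" unfolding wei_def using red uniq by blast
  ultimately show ?thesis using red by simp
qed

lemma
  assumes "is_partition p" "s > 0"
  shows partition_cor: "is_partition (cor s p)"
    and charge_cor: "charge (int s) (beads (cor s p)) = charge (int s) (beads p)"
    and psize_cor: "psize p = psize (cor s p) + s * wei s p"
    and cor_down_closed: "\<And>b. b \<in> beads (cor s p) \<Longrightarrow> b - int s \<in> beads (cor s p)"
    and wei_eq_card_inversions: "wei s p = card (inversions (int s) (beads p))"
  using reduces_to_core_invariants[OF assms reduces_to_core_cor_wei[OF assms]] by auto

lemma beads_cor:
  assumes "is_partition p" "s > 0"
  shows "beads (cor s p) = {y. charge (int s) (beads p) y > 0}"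
  using beads_reduces_to_core[OF assms reduces_to_core_cor_wei[OF assms]] .

lemma cor_eq_iff:
  assumes "is_partition p" "is_partition q" "s > 0"
  shows "cor s p = cor s q \<longleftrightarrow> charge (int s) (beads p) = charge (int s) (beads q)"
proof
  assume "cor s p = cor s q"
  then show "charge (int s) (beads p) = charge (int s) (beads q)"
    using charge_cor assms by metis
next
  assume "charge (int s) (beads p) = charge (int s) (beads q)"
  then have "beads (cor s p) = beads (cor s q)" using assms by (simp add: beads_cor)
  then show "cor s p = cor s q" using beads_inj partition_cor assms by metis
qed

lemma cor_conjugate:
  assumes p: "is_partition p" and s: "s > 0"
  shows "cor s (conjugate p) = conjugate (cor s p)"
proof -
  let ?B = "beads p"
  \<comment> \<open>Reflection negates a charge; the additional 1 arises because position
    \<open>k\<close> of the line through \<open>y\<close> corresponds to position \<open>-k\<close>,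
    not \<open>-1 - k\<close>, of the line through \<open>-1 - y\<close>. Hence positive charges
    turn into nonpositive ones, which complements the core.\<close>
  have "charge (int s) (beads (conjugate p)) y = 1 - charge (int s) ?B (- 1 - y)" for y
  proof -
    let ?L = "line (int s) (- 1 - y) ?B"
    have L: "maya ?L" using maya_line maya_beads p s by simp
    have "line (int s) y (beads (conjugate p)) = {k. k + (- 1) \<in> {k. - 1 - k \<notin> ?L}}"
      by (auto simp: line_def beads_conjugate[OF p] algebra_simps)
    then show ?thesis using reg_shift[OF maya_reflect[OF L], of "- 1"] by (simp add: charge_def reg_reflect)
  qed
  then have "beads (cor s (conjugate p)) = beads (conjugate (cor s p))"
    using p s by (auto simp: beads_cor beads_conjugate partition_conjugate partition_cor)
  then show ?thesis using beads_inj partition_cor partition_conjugate p s by metis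
qed

section \<open>Rectangles\<close>

text \<open>An inversion \<open>(b, c)\<close> is encoded by \<open>k = (b - c) div s\<close>,
  \<open>j = b mod t\<close> and \<open>n = b div t\<close>, so that \<open>b = j + n * t\<close>
  and \<open>c = j - k * s + n * t\<close>. The bound \<open>K\<close> suffices because
  \<open>k\<close> is at most \<open>k * s = b - c\<close>.\<close>

lemma card_inversions_eq_sum:
  fixes s t :: int
  assumes s: "s > 0" and t: "t > 0" and B: "maya B" and K: "\<And>b c. b \<in> B \<Longrightarrow> c \<notin> B \<Longrightarrow> b - c \<le> K"
  shows "card (inversions s B) = (\<Sum>(k, j)\<in>{1..K} \<times> {0..<t}. card (line t j B - line t (j - k * s) B))"
proof -
  let ?S = "Sigma ({1..K} \<times> {0..<t}) (\<lambda>(k, j). line t j B - line t (j - k * s) B)"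
  have "bij_betw (\<lambda>((k, j), n). (j + n * t, j - k * s + n * t)) ?S (inversions s B)"
  proof (rule bij_betw_byWitness[where f' = "\<lambda>(b, c). (((b - c) div s, b mod t), b div t)"])
    show "\<forall>x\<in>?S. (\<lambda>(b, c). (((b - c) div s, b mod t), b div t)) ((\<lambda>((k, j), n). (j + n * t, j - k * s + n * t)) x) = x"
      using s t by auto
    show "\<forall>x\<in>inversions s B. (\<lambda>((k, j), n). (j + n * t, j - k * s + n * t)) ((\<lambda>(b, c). (((b - c) div s, b mod t), b div t)) x) = x"
    proof
      fix x assume x: "x \<in> inversions s B"
      obtain b c where bc: "x = (b, c)" by (cases x)
      then have "(b - c) div s * s = b - c" using x by (auto simp: inversions_def)
      then show "(\<lambda>((k, j), n). (j + n * t, j - k * s + n * t)) ((\<lambda>(b, c). (((b - c) div s, b mod t), b div t)) x) = x"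
        using bc by (simp add: mod_mult_div_eq algebra_simps)
    qed
    show "(\<lambda>((k, j), n). (j + n * t, j - k * s + n * t)) ` ?S \<subseteq> inversions s B"
      using s by (auto simp: inversions_def line_def)
    show "(\<lambda>(b, c). (((b - c) div s, b mod t), b div t)) ` inversions s B \<subseteq> ?S"
    proof (intro subsetI, elim imageE)
      fix y x assume x: "x \<in> inversions s B" and y: "y = (\<lambda>(b, c). (((b - c) div s, b mod t), b div t)) x"
      obtain b c where bc: "x = (b, c)" by (cases x)
      then have h: "b \<in> B" "c \<notin> B" "c < b" "s dvd b - c" using x by (auto simp: inversions_def)
      then obtain k where k: "b - c = s * k" by blast
      have k0: "k > 0" using h(3) k s by (metis diff_gt_0_iff_gt zero_less_mult_pos)
      have "k * 1 \<le> k * s" using k0 s by (intro mult_left_mono) auto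
      then have "k \<le> K" using K[OF h(1,2)] k by (simp add: mult.commute)
      have c: "c = b - k * s" using k by (simp add: algebra_simps)
      have "y = ((k, b mod t), b div t)" using y bc k s by simp
      moreover have "b div t \<in> line t (b mod t) B - line t (b mod t - k * s) B"
      proof -
        have "b mod t + b div t * t = b" by simp
        moreover from this have "b mod t - k * s + b div t * t = c" using c by linarith
        ultimately show ?thesis using h by (simp only: line_def Diff_iff mem_Collect_eq) simp
      qed
      ultimately show "y \<in> ?S" using k0 \<open>k \<le> K\<close> t by simp
    qed
  qed
  then have "card (inversions s B) = card ?S" by (rule bij_betw_same_card[symmetric])
  also have "\<dots> = (\<Sum>x\<in>{1..K} \<times> {0..<t}. card ((\<lambda>(k, j). line t j B - line t (j - k * s) B) x))"
    by (rule card_SigmaI) (auto intro: maya_finite_diff maya_line B t)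
  finally show ?thesis by (simp add: split_def)
qed

definition crossing_number :: "int \<Rightarrow> int \<Rightarrow> int set \<Rightarrow> int \<times> int \<Rightarrow> nat" where
  "crossing_number s t B = (\<lambda>(k, j).
     min (card (line t j B - line t (j - k * s) B)) (card (line t (j - k * s) B - line t j B)))"

lemma line_down_closed:
  assumes "maya C" "t > 0" "\<And>c. c \<in> C \<Longrightarrow> c - t \<in> C"
  shows "line t j C = {..<charge t C j}"
  using charge_pos_iff_mem[OF assms, of "j + _ * t"] charge_add_multiple[OF assms(1,2), of j]
  by (auto simp: line_def)

text \<open>In \<open>C\<close> every \<open>t\<close>-line is a ray, so its term is the positive
  part of a difference of charges. With \<open>X\<close> and \<open>Y\<close> the corresponding
  lines of \<open>B\<close>, that difference is \<open>|X - Y| - |Y - X|\<close>, and subtracting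
  its positive part from \<open>|X - Y|\<close> leaves the minimum of the two cardinalities.\<close>

lemma card_inversions_diff:
  fixes s t :: int
  assumes s: "s > 0" and t: "t > 0" and B: "maya B" and C: "maya C"
    and ch: "charge t C = charge t B" and cl: "\<And>c. c \<in> C \<Longrightarrow> c - t \<in> C"
  obtains K where "\<And>b c. b \<in> B \<Longrightarrow> c \<notin> B \<Longrightarrow> b - c \<le> K"
    "card (inversions s B) = card (inversions s C) + sum (crossing_number s t B) ({1..K} \<times> {0..<t})"
proof -
  obtain M N where w: "window M N B" "window M N C" using maya_common_window[OF B C] by blast
  have KB: "b - c \<le> N - M" if "b \<in> B" "c \<notin> B" for b c
    using window_lower[OF w(1) that(2)] window_upper[OF w(1) that(1)] by simp
  have KC: "b - c \<le> N - M" if "b \<in> C" "c \<notin> C" for b c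
    using window_lower[OF w(2) that(2)] window_upper[OF w(2) that(1)] by simp
  have eq: "card (line t j B - line t (j - k * s) B) =
      card (line t j C - line t (j - k * s) C) + crossing_number s t B (k, j)" for k j
  proof -
    let ?X = "line t j B" and ?Y = "line t (j - k * s) B"
    have "line t i C = {..<charge t B i}" for i using line_down_closed[OF C t] cl ch by simp
    then have "line t j C - line t (j - k * s) C = {charge t B (j - k * s)..<charge t B j}" by auto
    moreover have "charge t B j - charge t B (j - k * s) = int (card (?X - ?Y)) - int (card (?Y - ?X))"
      unfolding charge_def by (intro reg_diff maya_line B t)
    ultimately show ?thesis by (simp add: crossing_number_def)
  qed
  show thesis
    by (rule that[OF KB])
      (simp_all add: card_inversions_eq_sum[OF s t B KB] card_inversions_eq_sum[OF s t C KC] eq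
        sum.distrib split_def)
qed

definition rect :: "int \<Rightarrow> int \<Rightarrow> int set \<Rightarrow> int \<Rightarrow> int \<Rightarrow> int \<Rightarrow> bool" where
  "rect s t B a k l \<longleftrightarrow> a \<in> B \<and> a + k * s \<notin> B \<and> a + l * t \<notin> B \<and> a + k * s + l * t \<in> B"

lemma rect_swap: "rect t s B a l k \<longleftrightarrow> rect s t B a k l"
  by (auto simp: rect_def algebra_simps)

text \<open>Both side parameters may have either sign, so each rectangle is described twice, once
  from each of its bead corners.\<close>

lemma rect_antipode: "rect s t B a k l \<Longrightarrow> rect s t B (a + k * s + l * t) (- k) (- l)"
  by (auto simp: rect_def algebra_simps)

lemma rect_nonzero: "rect s t B a k l \<Longrightarrow> k \<noteq> 0 \<and> l \<noteq> 0"
  by (auto simp: rect_def)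

definition unique_rect :: "int \<Rightarrow> int \<Rightarrow> int set \<Rightarrow> bool" where
  "unique_rect s t B \<longleftrightarrow> (\<forall>a k l a' k' l'. rect s t B a k l \<longrightarrow> rect s t B a' k' l' \<longrightarrow>
     a' = a \<and> k' = k \<and> l' = l \<or> a' = a + k * s + l * t \<and> k' = - k \<and> l' = - l)"

lemma unique_rectD:
  assumes "unique_rect s t B" "rect s t B a k l" "rect s t B a' k' l'"
  shows "a' = a \<and> k' = k \<and> l' = l \<or> a' = a + k * s + l * t \<and> k' = - k \<and> l' = - l"
  using assms unfolding unique_rect_def by blast

lemma unique_rect_swap: "unique_rect s t B \<Longrightarrow> unique_rect t s B"
  unfolding unique_rect_def[of t s]
proof (intro allI impI)
  fix a k l a' k' l' assume u: "unique_rect s t B" "rect t s B a k l" "rect t s B a' k' l'"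
  then have "rect s t B a l k" "rect s t B a' l' k'" by (simp_all add: rect_swap)
  from unique_rectD[OF u(1) this]
  show "a' = a \<and> k' = k \<and> l' = l \<or> a' = a + k * t + l * s \<and> k' = - k \<and> l' = - l" by auto
qed

text \<open>A rectangle is the same as a choice of one element from each of the two difference sets
  whose cardinalities enter \<open>crossing_number\<close>; \<open>crossing_of_rect\<close> is the
  converse.\<close>

lemma rect_crossing:
  assumes "n \<in> line t (j - k * s) B - line t j B" "m \<in> line t j B - line t (j - k * s) B"
  shows "rect s t B (j - k * s + n * t) k (m - n)"
  using assms by (simp add: rect_def line_def algebra_simps)

lemma crossing_of_rect:
  assumes "rect s t B a k l" "j = (a + k * s) mod t" "n = (a + k * s) div t"
  shows "n \<in> line t (j - k * s) B - line t j B" "n + l \<in> line t j B - line t (j - k * s) B"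
proof -
  have "a = j - k * s + n * t" using assms(2,3) by (simp add: mod_mult_div_eq algebra_simps)
  then have "j - k * s + n * t = a" "j + n * t = a + k * s"
    "j - k * s + (n + l) * t = a + l * t" "j + (n + l) * t = a + k * s + l * t"
    by (simp_all add: algebra_simps)
  then show "n \<in> line t (j - k * s) B - line t j B" "n + l \<in> line t j B - line t (j - k * s) B"
    using assms(1) unfolding rect_def line_def Diff_iff mem_Collect_eq by metis+
qed

lemma crossing_number_pos:
  assumes "maya B" "t > 0"
  shows "crossing_number s t B (k, j) \<noteq> 0 \<longleftrightarrow>
    line t (j - k * s) B - line t j B \<noteq> {} \<and> line t j B - line t (j - k * s) B \<noteq> {}"
proof -
  have "card (line t x B - line t y B) = 0 \<longleftrightarrow> line t x B - line t y B = {}" for x y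
    using maya_finite_diff[OF maya_line maya_line, OF assms assms] by (simp only: card_eq_0_iff) blast
  moreover have "min m n \<noteq> 0 \<longleftrightarrow> m \<noteq> 0 \<and> n \<noteq> 0" for m n :: nat by (auto simp: min_def)
  ultimately show ?thesis unfolding crossing_number_def prod.case by blast
qed

lemma sum_crossing_number_unique:
  assumes B: "maya B" and t: "t > 0" and s: "s > 0" and K: "\<And>b c. b \<in> B \<Longrightarrow> c \<notin> B \<Longrightarrow> b - c \<le> K"
    and u: "unique_rect s t B" and r0: "rect s t B a0 k0 l0"
  shows "sum (crossing_number s t B) ({1..K} \<times> {0..<t}) = 1"
proof -
  \<comment> \<open>The sum only runs over positive \<open>k\<close>, so of the two descriptions the
    one with \<open>k > 0\<close> is taken.\<close>
  obtain a k l where r: "rect s t B a k l" and k: "k > 0"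
  proof (cases "k0 > 0")
    case False
    then have "- k0 > 0" using rect_nonzero[OF r0] by simp
    then show thesis using that rect_antipode[OF r0] by blast
  qed (use that r0 in blast)
  define j n where "j = (a + k * s) mod t" and "n = (a + k * s) div t"
  note c = crossing_of_rect[OF r j_def n_def]
  have only: "k' = k \<and> j' = j \<and> n' = n \<and> m' = n + l"
    if h: "k' > 0" "j' \<in> {0..<t}" "n' \<in> line t (j' - k' * s) B - line t j' B" "m' \<in> line t j' B - line t (j' - k' * s) B"
    for k' j' n' m'
  proof -
    have e: "j' - k' * s + n' * t = a" "k' = k" "m' - n' = l"
      using unique_rectD[OF u r rect_crossing[OF h(3,4)]] h(1) k by auto
    then have "a + k * s = j' + n' * t" by simp
    then have "j = j'" "n = n'" using h(2) t by (simp_all add: j_def n_def)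
    then show ?thesis using e by simp
  qed
  have jt: "j \<in> {0..<t}" using t by (simp add: j_def)
  have "crossing_number s t B (k, j) = 1"
  proof -
    have "line t (j - k * s) B - line t j B = {n}" "line t j B - line t (j - k * s) B = {n + l}"
      using only[OF k jt _ c(2)] only[OF k jt c(1)] c by blast+
    then show ?thesis by (simp add: crossing_number_def)
  qed
  moreover have "crossing_number s t B (k', j') = 0" if h: "k' > 0" "j' \<in> {0..<t}" "(k', j') \<noteq> (k, j)" for k' j'
    using crossing_number_pos[OF B t, of s k' j'] only[OF h(1,2)] h(3) by blast
  moreover have "k \<le> K"
  proof -
    have "a + k * s + l * t - (a + l * t) \<le> K" by (rule K) (use r in \<open>simp_all add: rect_def\<close>)
    moreover have "k * 1 \<le> k * s" using k s by (intro mult_left_mono) auto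
    ultimately show ?thesis by simp
  qed
  ultimately have "\<exists>x\<in>{1..K} \<times> {0..<t}. crossing_number s t B x = 1 \<and> (\<forall>y\<in>{1..K} \<times> {0..<t}. x \<noteq> y \<longrightarrow> crossing_number s t B y = 0)"
    using k jt by (intro bexI[of _ "(k, j)"]) auto
  then show ?thesis by (subst sum_eq_1_iff) auto
qed

text \<open>A sum of 1 singles out one index \<open>(k0, j0)\<close>, but the minimum being 1 makes
  only one of the two difference sets a singleton. Two rectangles may therefore still share just the
  bead \<open>a\<close> or just the gap \<open>a + l * t\<close>; the reversed roles of
  \<open>s\<close> and \<open>t\<close> must settle the rest.\<close>

lemma sum_crossing_number_1:
  assumes B: "maya B" and t: "t > 0" and s: "s > 0" and K: "\<And>b c. b \<in> B \<Longrightarrow> c \<notin> B \<Longrightarrow> b - c \<le> K"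
    and sum: "sum (crossing_number s t B) ({1..K} \<times> {0..<t}) = 1"
  shows "\<exists>a k l. rect s t B a k l"
    and "\<And>a k l a' k' l'. rect s t B a k l \<Longrightarrow> rect s t B a' k' l' \<Longrightarrow> k > 0 \<Longrightarrow> k' > 0 \<Longrightarrow>
      k' = k \<and> t dvd a' - a \<and> (a' = a \<or> a' + l' * t = a + l * t)"
proof -
  obtain k0 j0 where kj: "(k0, j0) \<in> {1..K} \<times> {0..<t}" "crossing_number s t B (k0, j0) = 1"
    and others: "\<forall>y\<in>{1..K} \<times> {0..<t}. (k0, j0) \<noteq> y \<longrightarrow> crossing_number s t B y = 0"
    using sum by (subst (asm) sum_eq_1_iff) auto
  obtain n m where "n \<in> line t (j0 - k0 * s) B - line t j0 B" "m \<in> line t j0 B - line t (j0 - k0 * s) B"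
    using crossing_number_pos[OF B t, of s k0 j0] kj(2) by auto
  from rect_crossing[OF this] show "\<exists>a k l. rect s t B a k l" by blast
  have at: "k = k0 \<and> (a + k * s) mod t = j0" if r: "rect s t B a k l" and k: "k > 0" for a k l
  proof -
    let ?j = "(a + k * s) mod t"
    have "crossing_number s t B (k, ?j) \<noteq> 0"
      unfolding crossing_number_pos[OF B t] using crossing_of_rect[OF r refl refl] by blast
    moreover have "k \<le> K"
    proof -
      have "a + k * s + l * t - (a + l * t) \<le> K" by (rule K) (use r in \<open>simp_all add: rect_def\<close>)
      moreover have "k * 1 \<le> k * s" using k s by (intro mult_left_mono) auto
      ultimately show ?thesis by simp
    qed
    moreover have "(k, ?j) \<in> {1..K} \<times> {0..<t}" if "k \<le> K" using that k t by simp
    ultimately show ?thesis using others by (metis prod.inject)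
  qed
  fix a k l a' k' l' assume r: "rect s t B a k l" "rect s t B a' k' l'" and k: "k > 0" "k' > 0"
  have kk: "k' = k" "k = k0" and j: "(a + k * s) mod t = j0" "(a' + k * s) mod t = j0"
    using at[OF r(1) k(1)] at[OF r(2) k(2)] by auto
  define n n' where "n = (a + k * s) div t" and "n' = (a' + k * s) div t"
  have an: "a = j0 - k * s + n * t" "a' = j0 - k * s + n' * t"
    unfolding n_def n'_def j(1)[symmetric] by (simp add: mod_mult_div_eq algebra_simps)
      (subst j(1), subst j(2)[symmetric], simp add: mod_mult_div_eq algebra_simps)
  have c: "n \<in> line t (j0 - k * s) B - line t j0 B" "n + l \<in> line t j0 B - line t (j0 - k * s) B"
    using crossing_of_rect[OF r(1) j(1)[symmetric] n_def] .
  have c': "n' \<in> line t (j0 - k * s) B - line t j0 B" "n' + l' \<in> line t j0 B - line t (j0 - k * s) B"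
    using crossing_of_rect[OF r(2)[unfolded kk(1)] j(2)[symmetric] n'_def] .
  \<comment> \<open>The singleton is either the set containing \<open>n\<close> and
    \<open>n'\<close> or the one containing \<open>n + l\<close> and \<open>n' + l'\<close>.\<close>
  consider "card (line t (j0 - k * s) B - line t j0 B) = 1" | "card (line t j0 B - line t (j0 - k * s) B) = 1"
    using kj(2) kk(2) by (auto simp: crossing_number_def min_def split: if_splits)
  then have "n = n' \<or> n + l = n' + l'"
    by cases (metis c(1) c'(1) card_1_singletonE singletonD, metis c(2) c'(2) card_1_singletonE singletonD)
  moreover have "a' + l' * t = a + l * t" if "n + l = n' + l'"
  proof -
    have "n * t + l * t = n' * t + l' * t" using that by (metis distrib_right)
    then show ?thesis using an by linarith
  qed
  moreover have "a' - a = (n' - n) * t" using an by (simp add: left_diff_distrib)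
  then have "t dvd a' - a" by simp
  ultimately show "k' = k \<and> t dvd a' - a \<and> (a' = a \<or> a' + l' * t = a + l * t)" using kk an by auto
qed

text \<open>If \<open>s\<close> divides \<open>l\<close>, the two sides in direction
  \<open>t\<close> connect points congruent modulo \<open>s * t\<close>. One of them leads downwards
  from a bead to a gap, whatever the sign of \<open>l\<close>.\<close>

lemma down_closed_not_dvd:
  fixes s t :: int
  assumes cl: "\<And>b. b \<in> B \<Longrightarrow> b - s * t \<in> B" and r: "rect s t B a k l"
  shows "\<not> s dvd l" "\<not> t dvd k"
proof -
  have *: "\<not> s dvd l" if cl: "\<And>b. b \<in> B \<Longrightarrow> b - s * t \<in> B" and r: "rect s t B a k l" for s t a k l
  proof
    assume "s dvd l"
    then obtain m where m: "l = s * m" by blast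
    have h: "a \<in> B" "a + k * s \<notin> B" "a + m * (s * t) \<notin> B" "a + k * s + m * (s * t) \<in> B"
      using r unfolding m rect_def by (simp_all add: algebra_simps)
    show False
    proof (cases "m \<ge> 0")
      case True
      from down_closed_multiple[of B "s * t", OF cl h(4) this] h(2) show False by simp
    next
      case False
      then have "- m \<ge> 0" by simp
      from down_closed_multiple[of B "s * t", OF cl h(1) this] h(3) show False by simp
    qed
  qed
  show "\<not> s dvd l" using *[OF cl r] .
  show "\<not> t dvd k" by (rule *[of t s a l k]) (use cl r in \<open>simp_all add: mult.commute rect_swap\<close>)
qed

lemma unique_rect_of_crossings:
  fixes s t :: int
  assumes co: "coprime s t" and cl: "\<And>b. b \<in> B \<Longrightarrow> b - s * t \<in> B"
    and st: "\<And>a k l a' k' l'. rect s t B a k l \<Longrightarrow> rect s t B a' k' l' \<Longrightarrow> k > 0 \<Longrightarrow> k' > 0 \<Longrightarrow>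
      k' = k \<and> t dvd a' - a \<and> (a' = a \<or> a' + l' * t = a + l * t)"
    and ts: "\<And>a k l a' k' l'. rect t s B a k l \<Longrightarrow> rect t s B a' k' l' \<Longrightarrow> k > 0 \<Longrightarrow> k' > 0 \<Longrightarrow>
      k' = k \<and> s dvd a' - a \<and> (a' = a \<or> a' + l' * s = a + l * s)"
  shows "unique_rect s t B"
proof -
  \<comment> \<open>Rectangles of opposite orientation: with the antipode of the second, the two
    hypotheses yield congruences modulo \<open>t\<close> and \<open>s\<close>, hence
    \<open>a'\<close> is congruent to \<open>a + l * t\<close> modulo \<open>s * t\<close>. Then
    bead \<open>a'\<close> and gap \<open>a + l * t\<close> share an \<open>s * t\<close>-line, as
    do gap \<open>a' + k * s\<close> and bead \<open>a + l * t + k * s\<close>, with the same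
    displacement; one of these pairs violates closure.\<close>
  have opp: False if r: "rect s t B a k l" "rect s t B a' k' l'" and k: "k > 0" "k' > 0" and l: "l > 0" "l' < 0"
    for a k l a' k' l'
  proof -
    have 1: "k' = k" "t dvd a' - a" using st[OF r k] by auto
    have r': "rect t s B a l k" "rect t s B (a' + k' * s + l' * t) (- l') (- k')"
      using r rect_antipode by (simp_all add: rect_swap)
    then have 2: "l' = - l" "s dvd a' + k' * s + l' * t - a" using ts[OF r'] l by auto
    have "a' + k' * s + l' * t - a = (a' - a - l * t) + k' * s" unfolding 2(1) by simp
    then have "s dvd (a' - a - l * t) + k' * s" using 2(2) by metis
    then have "s dvd a' - a - l * t" by (simp add: dvd_add_left_iff)
    moreover have "t dvd a' - a - l * t" using 1 by simp
    ultimately have "s * t dvd a' - a - l * t" using co by (simp add: divides_mult)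
    then obtain m where "a' - a - l * t = s * t * m" by blast
    then have m: "a' = a + l * t + m * (s * t)" by (simp add: algebra_simps)
    have h: "a' \<in> B" "a' + k * s \<notin> B" "a + l * t \<notin> B" "a + l * t + k * s \<in> B"
      using r 1(1) by (simp_all add: rect_def algebra_simps)
    show False
    proof (cases "m \<ge> 0")
      case True
      from down_closed_multiple[of B "s * t", OF cl h(1) this] m h(3) show False by simp
    next
      case False
      then have "- m \<ge> 0" by simp
      from down_closed_multiple[of B "s * t", OF cl h(4) this] m h(2) show False by (simp add: algebra_simps)
    qed
  qed
  \<comment> \<open>For equal orientation the hypothesis with \<open>s\<close> and \<open>t\<close>
    interchanged gives \<open>l' = l\<close>, and then both alternatives left by \<open>st\<close>
    say \<open>a' = a\<close>.\<close>
  have pos: "a' = a \<and> k' = k \<and> l' = l" if r: "rect s t B a k l" "rect s t B a' k' l'" and k: "k > 0" "k' > 0"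
    for a k l a' k' l'
  proof -
    have 1: "k' = k" "a' = a \<or> a' + l' * t = a + l * t" using st[OF r k] by auto
    consider "l > 0" "l' > 0" | "l < 0" "l' < 0" | "l > 0" "l' < 0" | "l < 0" "l' > 0"
      using rect_nonzero[OF r(1)] rect_nonzero[OF r(2)] by linarith
    then have "l' = l"
    proof cases
      case 1
      then show ?thesis using ts[of a l k a' l' k'] r by (simp add: rect_swap)
    next
      case 2
      then show ?thesis
        using ts[of "a + k * s + l * t" "- l" "- k" "a' + k' * s + l' * t" "- l'" "- k'"] r rect_antipode
        by (simp add: rect_swap)
    qed (use opp[OF r k] opp[OF r(2,1) k(2,1)] in auto)
    then show ?thesis using 1 by auto
  qed
  show ?thesis unfolding unique_rect_def
  proof (intro allI impI)
    fix a k l a' k' l' assume r: "rect s t B a k l" "rect s t B a' k' l'"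
    note ra = rect_antipode[OF r(1)] rect_antipode[OF r(2)]
    consider "k > 0" "k' > 0" | "k > 0" "- k' > 0" | "- k > 0" "k' > 0" | "- k > 0" "- k' > 0"
      using rect_nonzero[OF r(1)] rect_nonzero[OF r(2)] by linarith
    then show "a' = a \<and> k' = k \<and> l' = l \<or> a' = a + k * s + l * t \<and> k' = - k \<and> l' = - l"
    proof cases
      case 1 then show ?thesis using pos[OF r] by simp
    next
      case 2 then show ?thesis using pos[OF r(1) ra(2)] by auto
    next
      case 3 then show ?thesis using pos[OF ra(1) r(2)] by auto
    next
      case 4 then show ?thesis using pos[OF ra] by auto
    qed
  qed
qed

text \<open>Equal charges mean that each residue class modulo \<open>s\<close> meets
  \<open>B - C\<close> and \<open>C - B\<close> equally often, and \<open>h\<close> is constant on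
  the class.\<close>

lemma sum_periodic:
  fixes h :: "int \<Rightarrow> int"
  assumes B: "maya B" and C: "maya C" and s: "s > 0" and ch: "charge s C = charge s B"
    and h: "\<And>x y. s dvd x - y \<Longrightarrow> h x = h y"
  shows "sum h (B - C) = sum h (C - B)"
proof -
  have *: "sum h (X - Y) = (\<Sum>i\<in>{0..<s}. int (card (line s i X - line s i Y)) * h i)" if X: "maya X" and Y: "maya Y" for X Y
  proof -
    have "sum h (X - Y) = (\<Sum>i\<in>{0..<s}. \<Sum>x\<in>{x \<in> X - Y. x mod s = i}. h x)"
      by (rule sum.group[symmetric]) (use maya_finite_diff[OF X Y] s in auto)
    also have "\<dots> = (\<Sum>i\<in>{0..<s}. int (card (line s i X - line s i Y)) * h i)"
    proof (rule sum.cong[OF refl])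
      fix i assume i: "i \<in> {0..<s}"
      have "bij_betw (\<lambda>n. i + n * s) (line s i X - line s i Y) {x \<in> X - Y. x mod s = i}"
        by (rule bij_betw_byWitness[where f' = "\<lambda>x. x div s"])
          (use i s in \<open>auto simp: line_def mod_mult_div_eq\<close>)
      then have "card {x \<in> X - Y. x mod s = i} = card (line s i X - line s i Y)"
        by (metis bij_betw_same_card)
      moreover have "(\<Sum>x\<in>{x \<in> X - Y. x mod s = i}. h x) = (\<Sum>x\<in>{x \<in> X - Y. x mod s = i}. h i)"
        by (rule sum.cong[OF refl], rule h) (auto simp: mod_eq_dvd_iff[symmetric])
      ultimately show "(\<Sum>x\<in>{x \<in> X - Y. x mod s = i}. h x) = int (card (line s i X - line s i Y)) * h i" by simp
    qed
    finally show ?thesis .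
  qed
  have "int (card (line s i B - line s i C)) = int (card (line s i C - line s i B))" for i
    using reg_diff[OF maya_line[OF B s] maya_line[OF C s], of i i] fun_cong[OF ch, of i] by (simp add: charge_def)
  then show ?thesis using *[OF B C] *[OF C B] by simp
qed

text \<open>The \<open>t\<close>-charge at \<open>y\<close> differs from \<open>- (y div t)\<close>
  by a bounded amount, so along a line with positive step it is large far to the left and small far
  to the right.\<close>

lemma maya_charge_level:
  assumes B: "maya B" and s: "s > 0" and t: "t > 0"
  shows "maya {k. charge t B (x + k * s) > c}"
proof -
  let ?f = "charge t B"
  have "finite ((\<lambda>y. \<bar>?f y\<bar>) ` {0..<t})" by simp
  then obtain A where A: "\<And>y. y \<in> {0..<t} \<Longrightarrow> \<bar>?f y\<bar> \<le> A" by (metis Max_ge imageI)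
  have f: "- A - y div t \<le> ?f y" "?f y \<le> A - y div t" for y
  proof -
    have "?f y = ?f (y mod t) - y div t"
      using charge_add_multiple[OF B t, of "y mod t" "y div t"] by (simp add: mod_mult_div_eq mult.commute)
    moreover have "\<bar>?f (y mod t)\<bar> \<le> A" using A t by simp
    ultimately show "- A - y div t \<le> ?f y" "?f y \<le> A - y div t" by linarith+
  qed
  let ?L = "\<bar>x\<bar> + t * (\<bar>A\<bar> + \<bar>c\<bar> + 1)"
  have "0 \<le> t * (\<bar>A\<bar> + \<bar>c\<bar> + 1)" using t by simp
  then have L0: "?L \<ge> 0" by simp
  show ?thesis
  proof (rule mayaI[of "- ?L" _ ?L])
    fix k assume k: "k < - ?L"
    then have "k * s \<le> k * 1" using L0 s by (intro mult_left_mono_neg) auto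
    then have "x + k * s < t * (- (\<bar>A\<bar> + \<bar>c\<bar> + 1))" using k by (simp add: algebra_simps)
    then have "(x + k * s) div t < - (\<bar>A\<bar> + \<bar>c\<bar> + 1)"
      using t by (smt (verit) div_mult_mod_eq mult.commute mult_left_mono pos_mod_sign)
    then show "k \<in> {k. ?f (x + k * s) > c}" using f(1)[of "x + k * s"] by simp
  next
    fix k assume k: "k \<in> {k. ?f (x + k * s) > c}"
    show "k < ?L"
    proof (rule ccontr)
      assume n: "\<not> k < ?L"
      then have "k * 1 \<le> k * s" using L0 s by (intro mult_left_mono) auto
      then have "x + k * s \<ge> t * (\<bar>A\<bar> + \<bar>c\<bar> + 1)" using n by simp
      then have "(x + k * s) div t \<ge> \<bar>A\<bar> + \<bar>c\<bar> + 1"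
        using zdiv_mono1[OF _ t] t by (metis nonzero_mult_div_cancel_left less_irrefl)
      then show False using f(2)[of "x + k * s"] k by simp
    qed
  qed
qed

section \<open>Partitions with the same size and the same cores\<close>

text \<open>The first alternative covers the two bead corners and the second the two gap corners,
  opposite ones being exchanged by \<open>rect_antipode\<close>.\<close>

definition corner :: "int \<Rightarrow> int \<Rightarrow> int set \<Rightarrow> int \<Rightarrow> bool" where
  "corner s t B x \<longleftrightarrow> (\<exists>k l. rect s t B x k l) \<or> (\<exists>k l. rect s t B (x + k * s) (- k) l)"

text \<open>Any further element of the two difference sets would produce a second rectangle. Both
  are thus singletons, so rectangles occur only between points with tied charges.\<close>

lemma unique_rect_charge_eq:
  assumes B: "maya B" and t: "t > 0" and u: "unique_rect s t B" and r: "rect s t B a k l"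
  shows "charge t B (a + k * s) = charge t B a"
proof -
  have k: "k \<noteq> 0" using rect_nonzero[OF r] by simp
  have "line t a B - line t (a + k * s) B = {0}"
  proof -
    have "n = 0" if n: "n \<in> line t a B - line t (a + k * s) B" for n
    proof -
      have "rect s t B (a + n * t) k (l - n)" using n r by (simp add: rect_def line_def algebra_simps)
      from unique_rectD[OF u r this] show ?thesis using k t by auto
    qed
    moreover have "0 \<in> line t a B - line t (a + k * s) B" using r by (simp add: rect_def line_def)
    ultimately show ?thesis by blast
  qed
  moreover have "line t (a + k * s) B - line t a B = {l}"
  proof -
    have "n = l" if n: "n \<in> line t (a + k * s) B - line t a B" for n
    proof -
      have "rect s t B a k n" using n r by (simp add: rect_def line_def)
      from unique_rectD[OF u r this] show ?thesis using k by auto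
    qed
    moreover have "l \<in> line t (a + k * s) B - line t a B" using r by (simp add: rect_def line_def)
    ultimately show ?thesis by blast
  qed
  ultimately show ?thesis
    using reg_diff[OF maya_line[OF B t] maya_line[OF B t], of a "a + k * s"] by (simp add: charge_def)
qed

text \<open>Sort the points of the line \<open>x + \<int> s\<close> by decreasing \<open>t\<close>-charge. If there is no rectangle, then the beads on
  this line come first; the potential is (twice) the rank of \<open>x\<close> in this order, with ties averaged,
  minus the number of beads on the line.\<close>

definition potential :: "int \<Rightarrow> int \<Rightarrow> int set \<Rightarrow> int \<Rightarrow> int" where
  "potential s t B x = reg {k. charge t B (x + k * s) > charge t B x}
     + reg {k. charge t B (x + k * s) > charge t B x - 1} - 2 * charge s B x"

section \<open>The sign of the potential and its zeros\<close>

context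
  fixes s t :: int and B :: "int set"
  assumes B: "maya B" and s: "s > 0" and t: "t > 0" and co: "coprime s t"
    and u: "unique_rect s t B" and cl: "\<And>b. b \<in> B \<Longrightarrow> b - s * t \<in> B"
begin

text \<open>A gap on the \<open>s\<close>-line of the bead \<open>x\<close> whose
  \<open>t\<close>-charge is not smaller gives a rectangle at \<open>x\<close>, for otherwise its
  \<open>t\<close>-line would be properly contained in that of \<open>x\<close>; the charges are
  then tied. So the points of larger charge are beads other than \<open>x\<close>, a loss of at
  least 1. The points of charge at least that of \<open>x\<close> are beads too, up to one corner if
  \<open>x\<close> is a corner, a gain of at most 1.\<close>

lemma potential_nonpos:
  assumes x: "x \<in> B"
  shows "potential s t B x \<le> 0" "\<not> corner s t B x \<Longrightarrow> potential s t B x < 0"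
proof -
  let ?f = "charge t B"
  let ?U1 = "{k. ?f (x + k * s) > ?f x}" and ?U2 = "{k. ?f (x + k * s) > ?f x - 1}" and ?V = "line s x B"
  have m: "maya ?U1" "maya ?U2" "maya ?V" using maya_charge_level[OF B s t] maya_line[OF B s] by auto
  have ex: "\<exists>l. rect s t B x k l" if k: "?f (x + k * s) \<ge> ?f x" "x + k * s \<notin> B" for k
  proof (rule ccontr)
    assume "\<not> ?thesis"
    then have "line t (x + k * s) B \<subseteq> line t x B" using k(2) x by (auto simp: line_def rect_def)
    moreover have "0 \<in> line t x B" "0 \<notin> line t (x + k * s) B" using k(2) x by (auto simp: line_def)
    ultimately have "line t (x + k * s) B \<subset> line t x B" by blast
    from reg_strict_mono[OF maya_line[OF B t] maya_line[OF B t] this] k(1) show False by (simp add: charge_def)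
  qed
  have "?U1 \<subseteq> ?V"
  proof
    fix k assume k: "k \<in> ?U1"
    show "k \<in> ?V"
    proof (rule ccontr)
      assume "k \<notin> ?V"
      then obtain l where "rect s t B x k l" using ex[of k] k by (auto simp: line_def)
      from unique_rect_charge_eq[OF B t u this] k show False by simp
    qed
  qed
  moreover have "0 \<in> ?V" "0 \<notin> ?U1" using x by (auto simp: line_def)
  ultimately have "?U1 \<subset> ?V" by blast
  from reg_strict_mono[OF m(1,3) this] have 1: "reg ?U1 < charge s B x" by (simp add: charge_def)
  have 2: "k \<in> ?V \<or> (\<exists>l. rect s t B x k l)" if "k \<in> ?U2" for k using ex[of k] that by (auto simp: line_def)
  show "potential s t B x < 0" if "\<not> corner s t B x"
  proof -
    have "?U2 \<subseteq> ?V" using 2 that by (auto simp: corner_def)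
    from reg_mono[OF m(2,3) this] 1 show ?thesis by (simp add: potential_def charge_def)
  qed
  show "potential s t B x \<le> 0"
  proof (cases "\<exists>k l. rect s t B x k l")
    case False
    then have "?U2 \<subseteq> ?V" using 2 by auto
    from reg_mono[OF m(2,3) this] 1 show ?thesis by (simp add: potential_def charge_def)
  next
    case True
    then obtain k0 l0 where r0: "rect s t B x k0 l0" by blast
    \<comment> \<open>A second value of \<open>k\<close> would make \<open>x\<close> its own
      antipode, so that \<open>t\<close> divides \<open>k0 * s\<close> and hence
      \<open>k0\<close>.\<close>
    have "k = k0" if r: "rect s t B x k l" for k l
    proof (rule ccontr)
      assume "k \<noteq> k0"
      then have "k0 * s + l0 * t = 0" using unique_rectD[OF u r0 r] by auto
      then have "k0 * s = - (l0 * t)" by linarith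
      then have "t dvd k0 * s" by simp
      then have "t dvd k0" using co by (simp add: coprime_commute coprime_dvd_mult_left_iff)
      then show False using down_closed_not_dvd(2)[of B s t, OF cl r0] by simp
    qed
    then have "?U2 \<subseteq> insert k0 ?V" using 2 by blast
    from reg_mono[OF m(2) maya_insert[OF m(3)] this] have "reg ?U2 \<le> reg (insert k0 ?V)" .
    also have "\<dots> = reg ?V + 1" by (rule reg_insert[OF m(3)]) (use r0 in \<open>auto simp: rect_def line_def\<close>)
    finally show ?thesis using 1 by (simp add: potential_def charge_def)
  qed
qed

text \<open>Dual to \<open>potential_nonpos\<close>: now the beads of the line all have charge at
  least that of the gap \<open>x\<close>, and all but at most one of them have a strictly larger
  one.\<close>

lemma potential_nonneg:
  assumes x: "x \<notin> B"
  shows "potential s t B x \<ge> 0" "\<not> corner s t B x \<Longrightarrow> potential s t B x > 0"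
proof -
  let ?f = "charge t B"
  let ?U1 = "{k. ?f (x + k * s) > ?f x}" and ?U2 = "{k. ?f (x + k * s) > ?f x - 1}" and ?V = "line s x B"
  have m: "maya ?U1" "maya ?U2" "maya ?V" using maya_charge_level[OF B s t] maya_line[OF B s] by auto
  have ex: "\<exists>l. rect s t B (x + k * s) (- k) l" if k: "?f (x + k * s) \<le> ?f x" "x + k * s \<in> B" for k
  proof (rule ccontr)
    assume "\<not> ?thesis"
    then have "line t x B \<subseteq> line t (x + k * s) B" using k(2) x by (auto simp: line_def rect_def)
    moreover have "0 \<in> line t (x + k * s) B" "0 \<notin> line t x B" using k(2) x by (auto simp: line_def)
    ultimately have "line t x B \<subset> line t (x + k * s) B" by blast
    from reg_strict_mono[OF maya_line[OF B t] maya_line[OF B t] this] k(1) show False by (simp add: charge_def)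
  qed
  have "?V \<subseteq> ?U2"
  proof
    fix k assume k: "k \<in> ?V"
    show "k \<in> ?U2"
    proof (rule ccontr)
      assume n: "k \<notin> ?U2"
      then obtain l where "rect s t B (x + k * s) (- k) l" using ex[of k] k by (auto simp: line_def)
      from unique_rect_charge_eq[OF B t u this] n show False by simp
    qed
  qed
  moreover have "0 \<notin> ?V" "0 \<in> ?U2" using x by (auto simp: line_def)
  ultimately have "?V \<subset> ?U2" by blast
  from reg_strict_mono[OF m(3,2) this] have 1: "reg ?U2 > charge s B x" by (simp add: charge_def)
  have 2: "k \<in> ?U1 \<or> (\<exists>l. rect s t B (x + k * s) (- k) l)" if "k \<in> ?V" for k
    using ex[of k] that by (cases "?f (x + k * s) \<le> ?f x") (auto simp: line_def)
  show "potential s t B x > 0" if "\<not> corner s t B x"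
  proof -
    have "?V \<subseteq> ?U1" using 2 that by (auto simp: corner_def)
    from reg_mono[OF m(3,1) this] 1 show ?thesis by (simp add: potential_def charge_def)
  qed
  show "potential s t B x \<ge> 0"
  proof (cases "\<exists>k l. rect s t B (x + k * s) (- k) l")
    case False
    then have "?V \<subseteq> ?U1" using 2 by auto
    from reg_mono[OF m(3,1) this] 1 show ?thesis by (simp add: potential_def charge_def)
  next
    case True
    then obtain k0 l0 where r0: "rect s t B (x + k0 * s) (- k0) l0" by blast
    have "k = k0" if r: "rect s t B (x + k * s) (- k) l" for k l
    proof (rule ccontr)
      assume "k \<noteq> k0"
      then have "k * s = l0 * t" using unique_rectD[OF u r0 r] by auto
      then have "t dvd k * s" by simp
      then have "t dvd - k" using co by (simp add: coprime_commute coprime_dvd_mult_left_iff)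
      then show False using down_closed_not_dvd(2)[of B s t, OF cl r] by simp
    qed
    then have "?V \<subseteq> insert k0 ?U1" using 2 by blast
    from reg_mono[OF m(3) maya_insert[OF m(1)] this] have "reg ?V \<le> reg (insert k0 ?U1)" .
    also have "\<dots> = reg ?U1 + 1"
      by (rule reg_insert[OF m(1)]) (use unique_rect_charge_eq[OF B t u r0] in auto)
    finally show ?thesis using 1 by (simp add: potential_def charge_def)
  qed
qed

text \<open>Equal cores and sizes give the potential the same sum over \<open>B - C\<close> and
  \<open>C - B\<close>. One sum is nonpositive and the other nonnegative, so every term vanishes,
  and the potential vanishes only at corners.\<close>

lemma differ_only_at_corners:
  assumes C: "maya C" and chs: "charge s C = charge s B" and cht: "charge t C = charge t B"
    and en: "\<Sum>(B - C) = \<Sum>(C - B)" and x: "(x \<in> B) \<noteq> (x \<in> C)"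
  shows "corner s t B x"
proof -
  let ?f = "charge t B" and ?R = "\<lambda>x. reg {k. charge t B (x + k * s) > charge t B x} + reg {k. charge t B (x + k * s) > charge t B x - 1}"
  have "sum ?R (B - C) = sum ?R (C - B)"
  proof (rule sum_periodic[OF B C t cht])
    fix x y assume "t dvd x - y"
    then obtain m where "x - y = t * m" by blast
    then have xy: "x = y + m * t" by (simp add: algebra_simps)
    have "?f (x + z) = ?f (y + z) - m" for z
      using charge_add_multiple[OF B t, of "y + z" m] by (simp add: xy algebra_simps)
    from this this[of 0] show "?R x = ?R y" by simp
  qed
  \<comment> \<open>The charge itself drifts by -1 per step \<open>s\<close>; adding
    \<open>x\<close> to \<open>s\<close> times the charge makes it periodic, and the sums of
    \<open>x\<close> agree by \<open>en\<close>.\<close>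
  moreover have "(\<Sum>x\<in>B - C. s * charge s B x + x) = (\<Sum>x\<in>C - B. s * charge s B x + x)"
  proof (rule sum_periodic[OF B C s chs])
    fix x y assume "s dvd x - y"
    then obtain m where "x - y = s * m" by blast
    then have xy: "x = y + m * s" by (simp add: algebra_simps)
    show "s * charge s B x + x = s * charge s B y + y"
      unfolding xy charge_add_multiple[OF B s] by (simp add: algebra_simps)
  qed
  then have "s * (\<Sum>x\<in>B - C. charge s B x) = s * (\<Sum>x\<in>C - B. charge s B x)"
    using en by (simp add: sum.distrib sum_distrib_left)
  then have "(\<Sum>x\<in>B - C. charge s B x) = (\<Sum>x\<in>C - B. charge s B x)" using s by simp
  ultimately have eq: "sum (potential s t B) (B - C) = sum (potential s t B) (C - B)"
    unfolding potential_def by (simp add: sum_subtractf sum_distrib_left[symmetric])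
  have fin: "finite (B - C)" "finite (C - B)" using maya_finite_diff B C by blast+
  have neg: "potential s t B y \<le> 0" if "y \<in> B - C" for y using potential_nonpos(1) that by blast
  have pos: "potential s t B y \<ge> 0" if "y \<in> C - B" for y using potential_nonneg(1) that by blast
  have "sum (potential s t B) (B - C) \<le> 0" "sum (potential s t B) (C - B) \<ge> 0"
    using sum_nonpos[of "B - C", OF neg] sum_nonneg[of "C - B", OF pos] by auto
  then have z: "sum (potential s t B) (B - C) = 0" "sum (potential s t B) (C - B) = 0" using eq by auto
  have "potential s t B x = 0"
  proof (cases "x \<in> B")
    case True
    have "(\<Sum>y\<in>B - C. - potential s t B y) = 0" using z by (simp add: sum_negf)
    then have "\<forall>y\<in>B - C. - potential s t B y = 0"
      using neg by (subst (asm) sum_nonneg_eq_0_iff[OF fin(1)]) auto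
    then show ?thesis using True x by simp
  next
    case False
    then show ?thesis using z(2) pos x sum_nonneg_eq_0_iff[OF fin(2), of "potential s t B"] by auto
  qed
  then show ?thesis using potential_nonpos(2)[of x] potential_nonneg(2)[of x] by (cases "x \<in> B") auto
qed

lemma corner_cases:
  assumes r: "rect s t B a k l" and x: "corner s t B x"
  shows "x \<in> {a, a + k * s, a + l * t, a + k * s + l * t}"
  using x unfolding corner_def
proof (elim disjE exE)
  fix k' l' assume "rect s t B x k' l'"
  from unique_rectD[OF u r this] show ?thesis by auto
next
  fix k' l' assume "rect s t B (x + k' * s) (- k') l'"
  from unique_rectD[OF u r this] show ?thesis by auto
qed

end

text \<open>If both or neither of \<open>x\<close> and \<open>y\<close> belonged to
  \<open>C\<close>, one of the two lines would be properly contained in the other, contrary to equal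
  charges.\<close>

lemma exchange_pair:
  assumes B: "maya B" and C: "maya C" and s: "s > 0" and ch: "charge s C = charge s B"
    and x: "x \<in> B" and y: "y \<notin> B" and xy: "s dvd y - x"
    and same: "\<And>z. s dvd z - x \<Longrightarrow> z \<noteq> x \<Longrightarrow> z \<noteq> y \<Longrightarrow> z \<in> C \<longleftrightarrow> z \<in> B"
  shows "x \<in> C \<longleftrightarrow> y \<notin> C"
proof -
  obtain k where "y - x = s * k" using xy by blast
  then have k: "y = x + k * s" by (simp add: algebra_simps)
  let ?U = "line s x B" and ?V = "line s x C"
  have reg: "reg ?U = reg ?V" using fun_cong[OF ch, of x] by (simp add: charge_def)
  have m: "maya ?U" "maya ?V" using maya_line B C s by auto
  have eq: "n \<in> ?V \<longleftrightarrow> n \<in> ?U" if "n \<noteq> 0" "n \<noteq> k" for n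
    using same[of "x + n * s"] that s k by (simp add: line_def)
  have 0: "0 \<in> ?U" "k \<notin> ?U" using x y k by (auto simp: line_def)
  show ?thesis
  proof (rule ccontr)
    assume "(x \<in> C) \<noteq> (y \<notin> C)"
    then consider "x \<in> C" "y \<in> C" | "x \<notin> C" "y \<notin> C" by blast
    then show False
    proof cases
      case 1
      then have "0 \<in> ?V" "k \<in> ?V" using k by (auto simp: line_def)
      then have "n \<in> ?V" if "n \<in> ?U" for n using eq[of n] that by metis
      then have "?U \<subset> ?V" using \<open>k \<in> ?V\<close> 0 by blast
      then show False using reg_strict_mono[OF m] reg by simp
    next
      case 2
      then have "0 \<notin> ?V" "k \<notin> ?V" using k by (auto simp: line_def)
      then have "n \<in> ?U" if "n \<in> ?V" for n using eq[of n] that by metis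
      then have "?V \<subset> ?U" using \<open>0 \<notin> ?V\<close> 0 by blast
      then show False using reg_strict_mono[OF m(2,1)] reg by simp
    qed
  qed
qed

section \<open>Members of the class with given size and cores\<close>

definition same_class :: "nat \<Rightarrow> nat \<Rightarrow> (nat \<Rightarrow> nat) \<Rightarrow> (nat \<Rightarrow> nat) \<Rightarrow> bool" where
  "same_class s t p q \<longleftrightarrow> is_partition q \<and> psize q = psize p \<and> cor s q = cor s p \<and> cor t q = cor t p"

lemma same_class_beads:
  assumes "is_partition p" "s > 0" "t > 0"
  shows "same_class s t p q \<longleftrightarrow> is_partition q \<and> \<Sum>(beads p - beads q) = \<Sum>(beads q - beads p) \<and>
    charge (int s) (beads q) = charge (int s) (beads p) \<and> charge (int t) (beads q) = charge (int t) (beads p)"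
  unfolding same_class_def using psize_diff[OF assms(1), of q] cor_eq_iff[of q p] assms by auto

definition st_closed :: "nat \<Rightarrow> nat \<Rightarrow> (nat \<Rightarrow> nat) \<Rightarrow> bool" where
  "st_closed s t p \<longleftrightarrow> (\<forall>b\<in>beads p. b - int s * int t \<in> beads p)"

text \<open>All differences between \<open>p\<close> and \<open>q\<close> lie at corners. Applying
  \<open>exchange_pair\<close> to three sides of the rectangle ties its four corners together, so
  either none or all of them change.\<close>

lemma same_class_unique_rect:
  assumes p: "is_partition p" and s: "s > 0" and t: "t > 0" and co: "coprime s t"
    and st: "st_closed s t p" and u: "unique_rect (int s) (int t) (beads p)" and q: "same_class s t p q"
  shows "\<not> (\<exists>a k l. rect (int s) (int t) (beads p) a k l) \<Longrightarrow> q = p"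
    and "rect (int s) (int t) (beads p) a k l \<Longrightarrow> q \<noteq> p \<Longrightarrow>
      beads q = beads p - {a, a + k * int s + l * int t} \<union> {a + k * int s, a + l * int t}"
proof -
  let ?B = "beads p" and ?C = "beads q" and ?s = "int s" and ?t = "int t"
  have qp: "is_partition q" and en: "\<Sum>(?B - ?C) = \<Sum>(?C - ?B)"
    and ch: "charge ?s ?C = charge ?s ?B" "charge ?t ?C = charge ?t ?B"
    using q same_class_beads[OF p s t] by auto
  have mB: "maya ?B" and mC: "maya ?C" using maya_beads p qp by auto
  have co': "coprime ?s ?t" using co by simp
  have s': "?s > 0" "?t > 0" using s t by auto
  have cl: "\<And>b. b \<in> ?B \<Longrightarrow> b - ?s * ?t \<in> ?B" using st by (simp add: st_closed_def)
  have cor: "corner ?s ?t ?B x" if "(x \<in> ?B) \<noteq> (x \<in> ?C)" for x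
    using differ_only_at_corners[OF mB s' co' u _ mC ch en that] cl by blast
  show "q = p" if "\<not> (\<exists>a k l. rect ?s ?t ?B a k l)"
    using cor that beads_inj[OF qp p] by (auto simp: corner_def)
  assume r: "rect ?s ?t ?B a k l" and ne: "q \<noteq> p"
  let ?b = "a + k * ?s" and ?c = "a + l * ?t" and ?d = "a + k * ?s + l * ?t"
  have off: "x \<in> ?C \<longleftrightarrow> x \<in> ?B" if "x \<notin> {a, ?b, ?c, ?d}" for x
    using cor[of x] corner_cases[OF mB s' co' u _ r, of x] cl that by blast
  have mem: "a \<in> ?B" "?b \<notin> ?B" "?c \<notin> ?B" "?d \<in> ?B" using r by (auto simp: rect_def)
  \<comment> \<open>Ensures that the line through a side contains no further corner, as
    \<open>exchange_pair\<close> requires.\<close>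
  have nd: "\<not> ?s dvd l" "\<not> ?t dvd k" using down_closed_not_dvd[of ?B ?s ?t, OF cl r] by auto
  have nd': "\<not> ?s dvd l * ?t" "\<not> ?t dvd k * ?s"
    using nd co' by (simp_all add: coprime_dvd_mult_left_iff coprime_commute)
  have ab: "a \<in> ?C \<longleftrightarrow> ?b \<notin> ?C"
  proof (rule exchange_pair[OF mB mC s'(1) ch(1) mem(1,2)])
    fix z assume z: "?s dvd z - a" "z \<noteq> a" "z \<noteq> ?b"
    have "z \<noteq> ?c" using z nd' by auto
    moreover have "z \<noteq> ?d" using z nd' by (auto simp: dvd_add_right_iff)
    ultimately show "z \<in> ?C \<longleftrightarrow> z \<in> ?B" using off z by blast
  qed simp
  have ac: "a \<in> ?C \<longleftrightarrow> ?c \<notin> ?C"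
  proof (rule exchange_pair[OF mB mC s'(2) ch(2) mem(1,3)])
    fix z assume z: "?t dvd z - a" "z \<noteq> a" "z \<noteq> ?c"
    have "z \<noteq> ?b" using z nd' by auto
    moreover have "z \<noteq> ?d" using z nd' by (auto simp: dvd_add_left_iff)
    ultimately show "z \<in> ?C \<longleftrightarrow> z \<in> ?B" using off z by blast
  qed simp
  have dc: "?d \<in> ?C \<longleftrightarrow> ?c \<notin> ?C"
  proof (rule exchange_pair[OF mB mC s'(1) ch(1) mem(4,3)])
    fix z assume z: "?s dvd z - ?d" "z \<noteq> ?d" "z \<noteq> ?c"
    have "z \<noteq> a"
    proof
      assume "z = a"
      then have "?s dvd k * ?s + l * ?t" using z(1) by (simp add: dvd_diff_commute)
      then show False using nd' by (simp add: dvd_add_right_iff)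
    qed
    moreover have "z \<noteq> ?b" using z nd' by auto
    ultimately show "z \<in> ?C \<longleftrightarrow> z \<in> ?B" using off z by blast
  qed simp
  have "a \<notin> ?C"
  proof
    assume "a \<in> ?C"
    then have "x \<in> ?C \<longleftrightarrow> x \<in> ?B" for x
      using ab ac dc mem off[of x] by (cases "x \<in> {a, ?b, ?c, ?d}") auto
    then have "?C = ?B" by blast
    then show False using beads_inj[OF qp p] ne by blast
  qed
  then have "x \<in> ?C \<longleftrightarrow> x \<in> ?B - {a, ?d} \<union> {?b, ?c}" for x
    using ab ac dc mem off[of x] by (cases "x \<in> {a, ?b, ?c, ?d}") auto
  then show "?C = ?B - {a, ?d} \<union> {?b, ?c}" by blast
qed

text \<open>The swapped set arises by moving two beads along the parallel \<open>s\<close>-sides, or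
  equally along the \<open>t\<close>-sides. The first description preserves the
  \<open>s\<close>-charges, the second the \<open>t\<close>-charges, and the two displacements
  cancel in the size.\<close>

lemma ex_same_class_swap:
  assumes p: "is_partition p" and s: "s > 0" and t: "t > 0" and co: "coprime s t"
    and st: "st_closed s t p" and r: "rect (int s) (int t) (beads p) a k l"
  obtains q where "same_class s t p q"
    "beads q = beads p - {a, a + k * int s + l * int t} \<union> {a + k * int s, a + l * int t}"
proof -
  let ?B = "beads p" and ?s = "int s" and ?t = "int t"
  let ?b = "a + k * ?s" and ?c = "a + l * ?t" and ?d = "a + k * ?s + l * ?t"
  have mem: "a \<in> ?B" "?b \<notin> ?B" "?c \<notin> ?B" "?d \<in> ?B" using r by (auto simp: rect_def)
  have "\<not> ?t dvd k" using down_closed_not_dvd(2)[of ?B ?s ?t, OF _ r] st by (auto simp: st_closed_def)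
  then have nd: "\<not> ?t dvd k * ?s" using co by (simp add: coprime_dvd_mult_left_iff coprime_commute)
  have "k * ?s \<noteq> l * ?t" "k * ?s \<noteq> - l * ?t" using nd by (metis dvd_triv_right)+
  then have ne: "?b \<noteq> ?c" "?d \<noteq> a" by auto
  have m: "maya ?B" using maya_beads p by blast
  let ?B1 = "move_bead a ?b ?B" and ?B2 = "move_bead a ?c ?B"
  have m1: "?d \<in> ?B1" "?c \<notin> ?B1" and m2: "?d \<in> ?B2" "?b \<notin> ?B2" using mem ne by (auto simp: move_bead_def)
  obtain q1 where q1: "is_partition q1" "beads q1 = ?B1" "int (psize q1) = int (psize p) + ?b - a"
    using ex_partition_move_bead[OF p mem(1,2)] .
  obtain q where q: "is_partition q" "beads q = move_bead ?d ?c ?B1" "int (psize q) = int (psize q1) + ?c - ?d"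
    using ex_partition_move_bead[OF q1(1), of ?d ?c] m1 unfolding q1(2) by blast
  have eq: "move_bead ?d ?c ?B1 = ?B - {a, ?d} \<union> {?b, ?c}" "move_bead ?d ?b ?B2 = ?B - {a, ?d} \<union> {?b, ?c}"
    using mem ne by (auto simp: move_bead_def)
  have "charge ?s (beads q) = charge ?s ?B"
    unfolding q(2) using charge_move_bead[OF maya_move_bead[OF m] _ m1] charge_move_bead[OF m _ mem(1,2)] s
    by (auto simp: fun_eq_iff)
  moreover have "charge ?t (beads q) = charge ?t ?B"
    unfolding q(2) eq(1) eq(2)[symmetric]
    using charge_move_bead[OF maya_move_bead[OF m] _ m2] charge_move_bead[OF m _ mem(1,3)] t
    by (auto simp: fun_eq_iff)
  ultimately have "same_class s t p q"
    unfolding same_class_def using q q1(3) cor_eq_iff[OF q(1) p] s t by auto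
  then show thesis using that q(2) eq(1) by simp
qed

section \<open>Weight differences and the case of a bead movable by \<open>s * t\<close>\<close>

definition defect :: "nat \<Rightarrow> nat \<Rightarrow> (nat \<Rightarrow> nat) \<Rightarrow> int" where
  "defect s t p = int (wei s p) - int (wei s (cor t p))"

lemma defect_eq_sum:
  assumes p: "is_partition p" and s: "s > 0" and t: "t > 0"
  obtains K where "\<And>b c. b \<in> beads p \<Longrightarrow> c \<notin> beads p \<Longrightarrow> b - c \<le> K"
    "defect s t p = int (sum (crossing_number (int s) (int t) (beads p)) ({1..K} \<times> {0..<int t}))"
proof -
  have s': "int s > 0" "int t > 0" using s t by auto
  have c: "is_partition (cor t p)" using partition_cor[OF p t] .
  obtain K where K: "\<And>b c. b \<in> beads p \<Longrightarrow> c \<notin> beads p \<Longrightarrow> b - c \<le> K"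
    "card (inversions (int s) (beads p)) = card (inversions (int s) (beads (cor t p)))
      + sum (crossing_number (int s) (int t) (beads p)) ({1..K} \<times> {0..<int t})"
    using card_inversions_diff[OF s' maya_beads[OF p] maya_beads[OF c] charge_cor[OF p t]] cor_down_closed[OF p t]
    by blast
  have "defect s t p = int (sum (crossing_number (int s) (int t) (beads p)) ({1..K} \<times> {0..<int t}))"
    using K(2) wei_eq_card_inversions[OF p s] wei_eq_card_inversions[OF c s] by (simp add: defect_def)
  then show thesis using that K(1) by blast
qed

text \<open>Lowering a bead by \<open>s * t\<close> keeps both cores and reduces the
  \<open>s\<close>-weight by \<open>t\<close>, while the defect of the resulting partition is still
  nonnegative.\<close>

lemma defect_not_st_closed:
  assumes p: "is_partition p" and s: "s > 0" and t: "t > 0" and n: "\<not> st_closed s t p"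
  shows "defect s t p \<ge> int t"
proof -
  obtain b where b: "b \<in> beads p" "b - int s * int t \<notin> beads p" using n by (auto simp: st_closed_def)
  obtain q where q: "is_partition q" "beads q = move_bead b (b - int s * int t) (beads p)"
    "int (psize q) = int (psize p) + (b - int s * int t) - b"
    using ex_partition_move_bead[OF p b] .
  have "charge (int s) (beads q) = charge (int s) (beads p)" "charge (int t) (beads q) = charge (int t) (beads p)"
    unfolding q(2) using charge_move_bead[OF maya_beads[OF p] _ b] s t by (auto simp: fun_eq_iff)
  then have c: "cor s q = cor s p" "cor t q = cor t p" using cor_eq_iff[OF q(1) p] s t by auto
  have "int (psize q) + int s * int t = int (psize p)" using q(3) by simp
  then have "psize q + s * t = psize p" by (metis of_nat_add of_nat_eq_iff of_nat_mult)
  then have "s * wei s p = s * (wei s q + t)"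
    using psize_cor[OF p s] psize_cor[OF q(1) s] c(1) by (simp add: algebra_simps)
  then have "wei s p = wei s q + t" using s by simp
  moreover have "defect s t q \<ge> 0" using defect_eq_sum[OF q(1) s t] by (metis of_nat_0_le_iff)
  ultimately show ?thesis using c by (simp add: defect_def)
qed

lemma maya_boundary: assumes "maya U" obtains k where "k \<in> U" "k + 1 \<notin> U"
proof -
  obtain M N where w: "window M N U" using assms by (rule mayaE)
  let ?F = "U \<inter> {M - 1..}"
  have fin: "finite ?F" by (rule finite_subset[of _ "{M - 1..<N}"]) (auto intro: window_upper[OF w])
  have "M - 1 \<in> ?F" using window_mem[OF w] by simp
  then have in_F: "Max ?F \<in> ?F" using Max_in[OF fin] by blast
  have "Max ?F + 1 \<notin> U"
  proof
    assume "Max ?F + 1 \<in> U"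
    then have "Max ?F + 1 \<in> ?F" using in_F by simp
    from Max_ge[OF fin this] show False by simp
  qed
  then show thesis using that in_F by blast
qed

text \<open>After lowering a bead by \<open>e = s * t\<close>, each residue class modulo
  \<open>e\<close> has a bead that can be raised by \<open>e\<close>. The results are pairwise
  distinct members of the class of \<open>p\<close>, and \<open>e > 2\<close> provides three of
  them.\<close>

lemma same_class_not_st_closed:
  assumes p: "is_partition p" and s: "s > 1" and t: "t > 1" and n: "\<not> st_closed s t p"
  shows "\<not> {q. same_class s t p q} \<subseteq> {x, y}"
proof -
  let ?B = "beads p" and ?s = "int s" and ?t = "int t"
  define e where "e = ?s * ?t"
  have st0: "s > 0" "t > 0" using s t by auto
  have "2 * 2 \<le> ?s * ?t" using s t by (intro mult_mono) auto
  then have e: "e > 2" by (simp add: e_def)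
  obtain b where b: "b \<in> ?B" "b - e \<notin> ?B" using n by (auto simp: st_closed_def e_def)
  obtain p1 where p1: "is_partition p1" "beads p1 = move_bead b (b - e) ?B" "int (psize p1) = int (psize p) + (b - e) - b"
    using ex_partition_move_bead[OF p b] .
  have dvd: "?s dvd e" "?t dvd e" by (auto simp: e_def)
  have ch1: "charge ?s (beads p1) = charge ?s ?B" "charge ?t (beads p1) = charge ?t ?B"
    unfolding p1(2) using charge_move_bead[OF maya_beads[OF p] _ b] st0 dvd by (auto simp: fun_eq_iff)
  have "\<exists>x q. x \<in> beads p1 \<and> x mod e = i \<and> same_class s t p q \<and> beads q = move_bead x (x + e) (beads p1)"
    if i: "0 \<le> i" "i < e" for i
  proof -
    have "maya (line e i (beads p1))" using maya_line maya_beads[OF p1(1)] e by simp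
    then obtain k where "k \<in> line e i (beads p1)" "k + 1 \<notin> line e i (beads p1)" by (rule maya_boundary)
    then have x: "i + k * e \<in> beads p1" "i + k * e + e \<notin> beads p1" by (auto simp: line_def algebra_simps)
    obtain q where q: "is_partition q" "beads q = move_bead (i + k * e) (i + k * e + e) (beads p1)"
      "int (psize q) = int (psize p1) + (i + k * e + e) - (i + k * e)"
      using ex_partition_move_bead[OF p1(1) x] .
    have "charge ?s (beads q) = charge ?s (beads p1)" "charge ?t (beads q) = charge ?t (beads p1)"
      unfolding q(2) using charge_move_bead[OF maya_beads[OF p1(1)] _ x] st0 dvd by (auto simp: fun_eq_iff)
    then have "same_class s t p q"
      unfolding same_class_def using q(1,3) p1(3) ch1 cor_eq_iff[OF q(1) p] st0 by auto
    moreover have "(i + k * e) mod e = i" using i by simp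
    ultimately show ?thesis using x(1) q(2) by blast
  qed
  then obtain X Q where XQ: "\<And>i. 0 \<le> i \<Longrightarrow> i < e \<Longrightarrow> X i \<in> beads p1 \<and> X i mod e = i \<and> same_class s t p (Q i) \<and>
      beads (Q i) = move_bead (X i) (X i + e) (beads p1)"
    by metis
  have dist: "Q i \<noteq> Q j" if ij: "0 \<le> i" "i < e" "0 \<le> j" "j < e" "i \<noteq> j" for i j
  proof -
    have "X i \<noteq> X j" using XQ[OF ij(1,2)] XQ[OF ij(3,4)] ij(5) by metis
    then have "X i \<in> beads (Q j)" using XQ[OF ij(1,2)] XQ[OF ij(3,4)] by (simp add: move_bead_def)
    moreover have "X i \<notin> beads (Q i)" using XQ[OF ij(1,2)] e by (simp add: move_bead_def)
    ultimately show ?thesis by auto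
  qed
  show ?thesis
  proof
    assume "{q. same_class s t p q} \<subseteq> {x, y}"
    then have "Q 0 \<in> {x, y}" "Q 1 \<in> {x, y}" "Q 2 \<in> {x, y}" using XQ[of 0] XQ[of 1] XQ[of 2] e by auto
    then show False using dist[of 0 1] dist[of 0 2] dist[of 1 2] e by auto
  qed
qed

text \<open>Reflection exchanges beads and gaps, so a self-conjugate \<open>p\<close> would have a
  second rectangle with parameters \<open>k\<close> and \<open>-l\<close>. Only one sign is
  reversed, so it is neither the given one nor its antipode.\<close>

lemma unique_rect_not_self_conjugate:
  assumes p: "is_partition p" and u: "unique_rect s t (beads p)" and r: "rect s t (beads p) a k l"
  shows "conjugate p \<noteq> p"
proof
  assume "conjugate p = p"
  then have c: "x \<in> beads p \<longleftrightarrow> - 1 - x \<notin> beads p" for x using beads_conjugate[OF p] by auto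
  have "rect s t (beads p) (- 1 - (a + k * s)) k (- l)"
    using r c[of a] c[of "a + k * s"] c[of "a + l * t"] c[of "a + k * s + l * t"]
    by (auto simp: rect_def algebra_simps)
  from unique_rectD[OF u r this] rect_nonzero[OF r] show False by auto
qed

lemma same_class_conjugate_iff:
  assumes "is_partition p" "s > 0" "t > 0"
  shows "same_class s t p (conjugate p) \<longleftrightarrow> self_conjugate (cor s p) \<and> self_conjugate (cor t p)"
  using assms by (simp add: same_class_def partition_conjugate psize_conjugate cor_conjugate self_conjugate_def)

section \<open>The equivalence\<close>

theorem theorem5p14:
  fixes s t :: nat and p :: "nat \<Rightarrow> nat"
  assumes "s > 1" and "t > 1" and "coprime s t" and "is_partition p"
  shows "(p \<noteq> conjugate p \<and>
          {q. is_partition q \<and> psize q = psize p \<and> cor s q = cor s p \<and> cor t q = cor t p}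
            = {p, conjugate p})
     \<longleftrightarrow>
         (self_conjugate (cor s p) \<and> self_conjugate (cor t p) \<and>
          int (wei s p) - int (wei s (cor t p)) = 1 \<and>
          int (wei t p) - int (wei t (cor s p)) = 1)"
proof -
  let ?B = "beads p" and ?s = "int s" and ?t = "int t"
  have s: "s > 0" and t: "t > 0" and s': "?s > 0" and t': "?t > 0" using assms by auto
  note p = assms(4) and co = assms(3)
  have B: "maya ?B" using maya_beads[OF p] .
  obtain K where K: "\<And>b c. b \<in> ?B \<Longrightarrow> c \<notin> ?B \<Longrightarrow> b - c \<le> K"
    "defect s t p = int (sum (crossing_number ?s ?t ?B) ({1..K} \<times> {0..<?t}))"
    using defect_eq_sum[OF p s t] by blast
  obtain L where L: "\<And>b c. b \<in> ?B \<Longrightarrow> c \<notin> ?B \<Longrightarrow> b - c \<le> L"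
    "defect t s p = int (sum (crossing_number ?t ?s ?B) ({1..L} \<times> {0..<?s}))"
    using defect_eq_sum[OF p t s] by blast
  have "(p \<noteq> conjugate p \<and> {q. same_class s t p q} = {p, conjugate p}) \<longleftrightarrow>
    same_class s t p (conjugate p) \<and> defect s t p = 1 \<and> defect t s p = 1"
  proof
    assume *: "p \<noteq> conjugate p \<and> {q. same_class s t p q} = {p, conjugate p}"
    then have cls: "same_class s t p q \<longleftrightarrow> q = p \<or> q = conjugate p" for q by blast
    have st: "st_closed s t p" using same_class_not_st_closed[OF p assms(1,2)] * by blast
    have cl: "\<And>b. b \<in> ?B \<Longrightarrow> b - ?s * ?t \<in> ?B" using st by (simp add: st_closed_def)
    \<comment> \<open>Swapping any rectangle gives a member of the class other than
      \<open>p\<close>, hence the conjugate. All rectangles therefore have the same pair of bead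
      corners and the same pair of gap corners.\<close>
    have sw: "?B - beads (conjugate p) = {a, a + k * ?s + l * ?t} \<and> beads (conjugate p) - ?B = {a + k * ?s, a + l * ?t}"
      if r: "rect ?s ?t ?B a k l" for a k l
    proof -
      obtain q where q: "same_class s t p q" "beads q = ?B - {a, a + k * ?s + l * ?t} \<union> {a + k * ?s, a + l * ?t}"
        using ex_same_class_swap[OF p s t co st r] .
      have mem: "a \<in> ?B" "a + k * ?s \<notin> ?B" "a + l * ?t \<notin> ?B" "a + k * ?s + l * ?t \<in> ?B"
        using r by (auto simp: rect_def)
      then have "a \<noteq> a + k * ?s" "a \<noteq> a + l * ?t" by metis+
      then have "a \<notin> beads q" unfolding q(2) by blast
      then have "q = conjugate p" using cls[of q] q(1) mem(1) by auto
      then have bc: "beads (conjugate p) = ?B - {a, a + k * ?s + l * ?t} \<union> {a + k * ?s, a + l * ?t}"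
        using q(2) by simp
      have "a + k * ?s \<notin> {a, a + k * ?s + l * ?t}" "a + l * ?t \<notin> {a, a + k * ?s + l * ?t}"
        using mem by (metis empty_iff insert_iff)+
      then show ?thesis unfolding bc using mem by blast
    qed
    have u: "unique_rect ?s ?t ?B"
      unfolding unique_rect_def
    proof (intro allI impI)
      fix a k l a' k' l' assume r: "rect ?s ?t ?B a k l" "rect ?s ?t ?B a' k' l'"
      have nd: "\<not> ?s dvd l * ?t"
        using down_closed_not_dvd(1)[of ?B ?s ?t, OF cl r(1)] co by (simp add: coprime_dvd_mult_left_iff)
      have ne: "k' * ?s \<noteq> l * ?t" "k' * ?s \<noteq> - (l * ?t)"
        using nd by (metis dvd_triv_right, metis dvd_minus_iff dvd_triv_right)
      have "{a', a' + k' * ?s + l' * ?t} = {a, a + k * ?s + l * ?t}" "{a' + k' * ?s, a' + l' * ?t} = {a + k * ?s, a + l * ?t}"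
        using sw[OF r(1)] sw[OF r(2)] by auto
      \<comment> \<open>Matching the corner pairs leaves the same rectangle, its antipode, and two
        mixed cases; the latter require \<open>k' * s\<close> to be \<open>l * t\<close> or its
        negative, excluded by \<open>ne\<close>.\<close>
      then consider "a' = a" "a' + k' * ?s = a + k * ?s" "a' + l' * ?t = a + l * ?t"
        | "a' = a" "a' + k' * ?s = a + l * ?t"
        | "a' = a + k * ?s + l * ?t" "a' + k' * ?s = a + k * ?s"
        | "a' = a + k * ?s + l * ?t" "a' + k' * ?s = a + l * ?t" "a' + l' * ?t = a + k * ?s"
        unfolding doubleton_eq_iff by blast
      then show "a' = a \<and> k' = k \<and> l' = l \<or> a' = a + k * ?s + l * ?t \<and> k' = - k \<and> l' = - l"
      proof cases
        case 1
        then show ?thesis using s' t' by auto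
      next
        case 4
        then have "(k' + k) * ?s = 0" "(l' + l) * ?t = 0" by (simp_all add: algebra_simps)
        then show ?thesis using 4 s' t' by auto
      qed (use ne in auto)
    qed
    \<comment> \<open>Without a rectangle \<open>p\<close> would be alone in its class, but its
      conjugate is a second member.\<close>
    have "\<exists>a k l. rect ?s ?t ?B a k l"
      using same_class_unique_rect(1)[OF p s t co st u, of "conjugate p"] cls[of "conjugate p"] * by auto
    then obtain a k l where r: "rect ?s ?t ?B a k l" by blast
    have "defect s t p = 1" using sum_crossing_number_unique[OF B t' s' K(1) u r] K(2) by simp
    moreover have "rect ?t ?s ?B a l k" using r rect_swap by blast
    then have "defect t s p = 1"
      using sum_crossing_number_unique[OF B s' t' L(1) unique_rect_swap[OF u]] L(2) by simp
    ultimately show "same_class s t p (conjugate p) \<and> defect s t p = 1 \<and> defect t s p = 1" using cls by blast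
  next
    assume *: "same_class s t p (conjugate p) \<and> defect s t p = 1 \<and> defect t s p = 1"
    \<comment> \<open>Otherwise the defect would be at least \<open>t\<close>, which exceeds
      1.\<close>
    have st: "st_closed s t p" using defect_not_st_closed[OF p s t] * assms(2) by force
    have cl: "\<And>b. b \<in> ?B \<Longrightarrow> b - ?s * ?t \<in> ?B" using st by (simp add: st_closed_def)
    have sums: "sum (crossing_number ?s ?t ?B) ({1..K} \<times> {0..<?t}) = 1"
      "sum (crossing_number ?t ?s ?B) ({1..L} \<times> {0..<?s}) = 1" 
      using * K(2) L(2) by (metis of_nat_1 of_nat_eq_iff)+
    note c1 = sum_crossing_number_1[OF B t' s' K(1) sums(1)] and c2 = sum_crossing_number_1[OF B s' t' L(1) sums(2)]
    obtain a k l where r: "rect ?s ?t ?B a k l" using c1(1) by blast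
    have u: "unique_rect ?s ?t ?B"
      by (rule unique_rect_of_crossings) (use co cl c1(2) c2(2) in \<open>simp, blast+\<close>)
    have ne: "conjugate p \<noteq> p" using unique_rect_not_self_conjugate[OF p u r] .
    have "q = conjugate p" if q: "same_class s t p q" "q \<noteq> p" for q
    proof (rule beads_inj)
      show "is_partition q" "is_partition (conjugate p)" using q p partition_conjugate by (auto simp: same_class_def)
      show "beads q = beads (conjugate p)"
        using same_class_unique_rect(2)[OF p s t co st u _ r] * q ne by blast
    qed
    moreover have "same_class s t p p" using p by (simp add: same_class_def)
    ultimately have "same_class s t p q \<longleftrightarrow> q = p \<or> q = conjugate p" for q using * by metis
    then show "p \<noteq> conjugate p \<and> {q. same_class s t p q} = {p, conjugate p}" using ne by auto
  qed
  then show ?thesis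
    unfolding same_class_conjugate_iff[OF p s t] by (simp add: same_class_def defect_def conj_assoc)
qed

end
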